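(* Let $\Omega$ be either $\mathbb{R}^3$ or the torus $(\mathbb{R}/\mathbb{Z})^3$, and correspondingly let $D=\mathbb{R}$ or $D=\mathbb{R}/\mathbb{Z}$. For real-valued functions $u_1,u_3$ on $D$ consider the shear flow $$u(x,t)=\bigl(u_1(x_2),\,0,\,u_3(x_1-t\,u_1(x_2))\bigr),\qquad x=(x_1,x_2,x_3)\in\Omega,\ t\in\mathbb{R}.$$ (i) If $u_1,u_3\in C^{1,\alpha}(D)$ with $\alpha\in(0,1]$, then $u(\cdot,t)\in C^{1,\alpha}(\Omega)$ for all $t\in\mathbb{R}$. (ii) If $u_1,u_3\in C^{0,\alpha}(D)$ with $\alpha\in(0,1)$, then $u(\cdot,t)\in C^{0,\alpha^2}(\Omega)$ for all $t\in\mathbb{R}$. (iii) There exist shear flows $u$ of the form $u(x,t)=\bigl(u_1(x_2),\,0,\,u_3(x_1-t\,u_1(x_2))\bigr)$, with $u_1,u_3$ real-valued functions on $D$, that are weak solutions of the three-dimensional incompressible Euler equations in $\Omega$ with initial data $u(\cdot,0)$, such that $u(\cdot,0)\in C^{0,\alpha}(\Omega)$ for some $\alpha\in(0,1)$, while for every $t\neq 0$ one has $u(\cdot,t)\notin C^{0,\beta}(\Omega)$ for any $\beta>\alpha^2$.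
   Context: Functions on $\mathbb{R}/\mathbb{Z}$ are identified with $1$-periodic functions on $\mathbb{R}$. For $\alpha\in(0,1]$, $C^{0,\alpha}$ denotes the space of bounded functions $f$ with $\sup_{x\ne y}|f(x)-f(y)|/|x-y|^\alpha<\infty$, and $C^{1,\alpha}$ the space of bounded $C^1$ functions whose first-order partial derivatives all belong to $C^{0,\alpha}$; a vector field belongs to such a space if all of its components do. The three-dimensional incompressible Euler equations are $\partial_t u+\nabla\cdot(u\otimes u)=-\nabla p$, $\nabla\cdot u=0$. A vector field $u\in L^2_{\rm loc}(\Omega\times[0,\infty))$ with values in $\mathbb{R}^3$ is a weak solution with initial data $u_0\in L^2_{\rm loc}(\Omega)$, $\nabla\cdot u_0=0$, if $u$ is divergence free in the sense of distributions in $\Omega\times[0,\infty)$ and if for every divergence-free (in $x$) vector field of test functions $\phi\in C_c^\infty(\Omega\times[0,\infty))$ one has $$\int_{\Omega\times[0,\infty)}\bigl[u\cdot\partial_t\phi+\langle u\otimes u,\nabla\phi\rangle\bigr]\,dx\,dt=-\int_\Omega u_0(x)\cdot\phi(x,0)\,dx,$$ where $\langle u\otimes u,\nabla\phi\rangle=\sum_{i,j}u_iu_j\,\partial_{x_j}\phi_i$. *)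

theory Defs
  imports "HOL-Analysis.Analysis"
begin

datatype domain = Whole_Space | Torus

text \<open>Functions on a torus are \<open>\<int>\<^sup>n\<close>-periodic functions on the covering space; the type
  \<^typ>\<open>'a\<close> is \<^typ>\<open>real\<close> for the scalar domain and \<^typ>\<open>real ^ 3\<close> for the spatial domain.\<close>

definition fun_on :: "domain \<Rightarrow> ('a::euclidean_space \<Rightarrow> 'b) \<Rightarrow> bool" where
  "fun_on \<Omega> f \<longleftrightarrow>
     (\<Omega> = Torus \<longrightarrow> (\<forall>x k. (\<forall>b\<in>Basis. k \<bullet> b \<in> \<int>) \<longrightarrow> f (x + k) = f x))"

text \<open>A fundamental domain, over which integrals are taken.\<close>

definition cell :: "domain \<Rightarrow> (real ^ 3) set" where
  "cell \<Omega> = (case \<Omega> of Whole_Space \<Rightarrow> UNIV | Torus \<Rightarrow> {x. \<forall>i. 0 \<le> x $ i \<and> x $ i < 1})"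

text \<open>Derivatives are taken within \<open>S\<close>, so that they are one-sided in time on the boundary
  of \<open>\<real>\<^sup>3 \<times> [0, \<infinity>)\<close>. They are unique on all sets \<open>S\<close> used below.\<close>

definition partial_deriv ::
    "'a::euclidean_space set \<Rightarrow> 'a \<Rightarrow> ('a \<Rightarrow> real) \<Rightarrow> 'a \<Rightarrow> real" where
  "partial_deriv S b f z = frechet_derivative f (at z within S) b"

primrec Ck_on :: "nat \<Rightarrow> 'a::euclidean_space set \<Rightarrow> ('a \<Rightarrow> real) \<Rightarrow> bool" where
  "Ck_on 0 S f \<longleftrightarrow> continuous_on S f"
| "Ck_on (Suc k) S f \<longleftrightarrow>
     f differentiable_on S \<and> (\<forall>b\<in>Basis. Ck_on k S (partial_deriv S b f))"

definition Cinf_on :: "'a::euclidean_space set \<Rightarrow> ('a \<Rightarrow> real) \<Rightarrow> bool" where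
  "Cinf_on S f \<longleftrightarrow> (\<forall>k. Ck_on k S f)"

definition C0_holder :: "domain \<Rightarrow> real \<Rightarrow> ('a::euclidean_space \<Rightarrow> real) set" where
  "C0_holder \<Omega> \<alpha> =
     {f. fun_on \<Omega> f \<and> bounded (range f) \<and>
         bdd_above {\<bar>f x - f y\<bar> / norm (x - y) powr \<alpha> | x y. x \<noteq> y}}"

definition C1_holder :: "domain \<Rightarrow> real \<Rightarrow> ('a::euclidean_space \<Rightarrow> real) set" where
  "C1_holder \<Omega> \<alpha> =
     {f. fun_on \<Omega> f \<and> bounded (range f) \<and> Ck_on 1 UNIV f \<and>
         (\<forall>b\<in>Basis. partial_deriv UNIV b f \<in> C0_holder \<Omega> \<alpha>)}"

definition componentwise :: "('a \<Rightarrow> real) set \<Rightarrow> ('a \<Rightarrow> real ^ 3) set" where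
  "componentwise X = {u. \<forall>i. (\<lambda>x. u x $ i) \<in> X}"

definition L2_loc :: "'a::euclidean_space set \<Rightarrow> ('a \<Rightarrow> real ^ 3) \<Rightarrow> bool" where
  "L2_loc S f \<longleftrightarrow> f \<in> borel_measurable (lebesgue_on S) \<and>
     (\<forall>K. compact K \<and> K \<subseteq> S \<longrightarrow> set_integrable lebesgue K (\<lambda>z. (norm (f z))\<^sup>2))"

definition spacetime :: "((real ^ 3) \<times> real) set" where
  "spacetime = UNIV \<times> {0..}"

abbreviation dx :: "3 \<Rightarrow> ((real ^ 3) \<times> real \<Rightarrow> real) \<Rightarrow> (real ^ 3) \<times> real \<Rightarrow> real" where
  "dx i \<equiv> partial_deriv spacetime (axis i 1, 0)"

abbreviation dt :: "((real ^ 3) \<times> real \<Rightarrow> real) \<Rightarrow> (real ^ 3) \<times> real \<Rightarrow> real" where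
  "dt \<equiv> partial_deriv spacetime (0, 1)"

text \<open>As \<open>\<real>\<^sup>3\<close> and \<open>\<real>\<^sup>3 \<times> [0, \<infinity>)\<close> are closed, compact support means that the function is
  nonzero only on a bounded set. On the torus this is measured on the fundamental cell and thus
  only restricts the support in time. Test functions need not vanish at time \<open>0\<close>.\<close>

definition test_fun_space :: "domain \<Rightarrow> (real ^ 3 \<Rightarrow> real) \<Rightarrow> bool" where
  "test_fun_space \<Omega> \<psi> \<longleftrightarrow>
     Cinf_on UNIV \<psi> \<and> fun_on \<Omega> \<psi> \<and> bounded {x \<in> cell \<Omega>. \<psi> x \<noteq> 0}"

definition test_fun :: "domain \<Rightarrow> ((real ^ 3) \<times> real \<Rightarrow> real) \<Rightarrow> bool" where
  "test_fun \<Omega> \<psi> \<longleftrightarrow>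
     Cinf_on spacetime \<psi> \<and> (\<forall>t\<ge>0. fun_on \<Omega> (\<lambda>x. \<psi> (x, t))) \<and>
     bounded {z \<in> cell \<Omega> \<times> {0..}. \<psi> z \<noteq> 0}"

definition div_free_space :: "domain \<Rightarrow> (real ^ 3 \<Rightarrow> real ^ 3) \<Rightarrow> bool" where
  "div_free_space \<Omega> u\<^sub>0 \<longleftrightarrow>
     (\<forall>\<psi>. test_fun_space \<Omega> \<psi> \<longrightarrow>
        (LINT x:cell \<Omega>|lebesgue. (\<Sum>i\<in>UNIV. u\<^sub>0 x $ i * partial_deriv UNIV (axis i 1) \<psi> x)) = 0)"

definition div_free :: "domain \<Rightarrow> (real ^ 3 \<Rightarrow> real \<Rightarrow> real ^ 3) \<Rightarrow> bool" where
  "div_free \<Omega> u \<longleftrightarrow>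
     (\<forall>\<psi>. test_fun \<Omega> \<psi> \<longrightarrow>
        set_lebesgue_integral lebesgue (cell \<Omega> \<times> {0..})
          (\<lambda>(x, t). \<Sum>i\<in>UNIV. u x t $ i * dx i \<psi> (x, t)) = 0)"

definition weak_solution ::
    "domain \<Rightarrow> (real ^ 3 \<Rightarrow> real \<Rightarrow> real ^ 3) \<Rightarrow> (real ^ 3 \<Rightarrow> real ^ 3) \<Rightarrow> bool" where
  "weak_solution \<Omega> u u\<^sub>0 \<longleftrightarrow>
     fun_on \<Omega> u\<^sub>0 \<and> L2_loc UNIV u\<^sub>0 \<and> div_free_space \<Omega> u\<^sub>0 \<and>
     (\<forall>t\<ge>0. fun_on \<Omega> (\<lambda>x. u x t)) \<and> L2_loc spacetime (\<lambda>(x, t). u x t) \<and> div_free \<Omega> u \<and>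
     (\<forall>\<phi>. (\<forall>i. test_fun \<Omega> (\<lambda>z. \<phi> z $ i)) \<and>
          (\<forall>z\<in>spacetime. (\<Sum>i\<in>UNIV. dx i (\<lambda>z. \<phi> z $ i) z) = 0) \<longrightarrow>
        set_lebesgue_integral lebesgue (cell \<Omega> \<times> {0..})
          (\<lambda>(x, t). (\<Sum>i\<in>UNIV. u x t $ i * dt (\<lambda>z. \<phi> z $ i) (x, t)) +
             (\<Sum>i\<in>UNIV. \<Sum>j\<in>UNIV. u x t $ i * u x t $ j * dx j (\<lambda>z. \<phi> z $ i) (x, t)))
        = - (LINT x:cell \<Omega>|lebesgue. u\<^sub>0 x \<bullet> \<phi> (x, 0)))"

definition shear_flow ::
    "(real \<Rightarrow> real) \<Rightarrow> (real \<Rightarrow> real) \<Rightarrow> real ^ 3 \<Rightarrow> real \<Rightarrow> real ^ 3" where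
  "shear_flow u1 u3 x t = vector [u1 (x $ 2), 0, u3 (x $ 1 - t * u1 (x $ 2))]"

end

theory Submission
  imports Defs "HOL-Real_Asymp.Real_Asymp"
begin

text \<open>The weak formulation is verified for merely continuous profiles, without approximation. In
  coordinates moving with the flow, \<open>x \<mapsto> x + t u\<^sub>1(x\<^sub>2) e\<^sub>1\<close>, the transport operator
  \<open>\<partial>\<^sub>t + u\<^sub>1 \<partial>\<^sub>1\<close> becomes a plain time derivative, and this change of variables only translates
  the lines parallel to \<open>e\<^sub>1\<close>, so that it preserves integrals by Fubini's theorem alone. All
  remaining terms are derivatives of test functions in a direction in which their coefficients
  are constant. The loss of regularity is exhibited by \<open>u\<^sub>1 = u\<^sub>3 = \<bar>sin (\<pi> s)\<bar>\<^bsup>1/2\<^esup>\<close>, for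
  which \<open>u\<^sub>3(- t u\<^sub>1(h))\<close> behaves like \<open>\<bar>h\<bar>\<^bsup>1/4\<^esup>\<close> near \<open>0\<close> whenever \<open>t \<noteq> 0\<close>.\<close>

section \<open>Integration along coordinate lines\<close>

text \<open>For a Hoelder profile the shear along e1 is in general only a homeomorphism, so no
  Jacobian formula applies to it; this forces the reduction to integrals over single lines. There
  only two facts are used, invariance under translation and the vanishing integral of a derivative.
  Both have a version for each domain: compact support and the translation invariance of Lebesgue
  measure on R, periodicity on R/Z. Since u2 = 0, the momentum integrand keeps the two time terms
  and the four products u_i u_j with i, j in {1, 3}. The time terms join the products with j = 1 to
  form u_i times the transport derivative of phi_i; the products with j = 3 have coefficients
  independent of x3. The exponent \<alpha> squared has one source: u3 is evaluated at a point
  displaced by t u1(x2), so two moduli of exponent \<alpha> are composed. For C^1 profiles the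
  displacement is Lipschitz and nothing is lost. To attain the loss, both profiles get their
  singularity at the same value 0, and u1 vanishes at its own singularity, so that the two cusps
  meet.\<close>

lemma integral_lborel_lines:
  fixes f :: "'a::euclidean_space \<Rightarrow> real"
  assumes f: "integrable lborel f" and b: "b \<in> Basis"
  shows "integral\<^sup>L lborel f =
    (\<integral>g. (\<integral>y. f ((\<Sum>c\<in>Basis - {b}. g c *\<^sub>R c) + y *\<^sub>R b) \<partial>lborel) \<partial>Pi\<^sub>M (Basis - {b}) (\<lambda>_. lborel))"
proof -
  interpret product_sigma_finite "\<lambda>_::'a. lborel :: real measure"
    by standard
  \<comment> \<open>\<open>T\<close> is the coordinate map of \<open>lborel_eq\<close>:
    \<open>lborel\<close> is the image under it of the product of one-dimensional Lebesgue measures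
    over \<open>Basis\<close>, and \<open>product_integral_insert\<close> splits off the factor
    \<open>b\<close>.\<close>
  define T where "T = (\<lambda>g::'a \<Rightarrow> real. \<Sum>c\<in>Basis. g c *\<^sub>R c)"
  have B: "insert b (Basis - {b}) = Basis"
    using b by auto
  have T_line: "T (g(b := y)) = (\<Sum>c\<in>Basis - {b}. g c *\<^sub>R c) + y *\<^sub>R b" for g y
    unfolding T_def by (subst sum.remove[OF _ b]) (auto intro!: sum.cong)
  have T [measurable]: "T \<in> Pi\<^sub>M Basis (\<lambda>_. lborel) \<rightarrow>\<^sub>M borel"
    unfolding T_def by measurable
  have fm [measurable]: "f \<in> borel_measurable borel"
    using f by (simp add: borel_measurable_integrable flip: measurable_lborel2)
  have int: "integrable (Pi\<^sub>M (insert b (Basis - {b})) (\<lambda>_. lborel)) (\<lambda>g. f (T g))"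
    unfolding B using f integrable_distr_eq[OF T, of f] by (simp add: T_def flip: lborel_eq)
  have "integral\<^sup>L lborel f = (\<integral>g. f (T g) \<partial>Pi\<^sub>M Basis (\<lambda>_. lborel))"
    by (subst lborel_eq) (simp add: integral_distr[OF T] flip: T_def)
  also have "\<dots> = (\<integral>g. (\<integral>y. f (T (g(b := y))) \<partial>lborel) \<partial>Pi\<^sub>M (Basis - {b}) (\<lambda>_. lborel))"
    using product_integral_insert[OF _ _ int] unfolding B by simp
  also have "\<dots> = (\<integral>g. (\<integral>y. f ((\<Sum>c\<in>Basis - {b}. g c *\<^sub>R c) + y *\<^sub>R b) \<partial>lborel) \<partial>Pi\<^sub>M (Basis - {b}) (\<lambda>_. lborel))"
    by (simp add: T_line)
  finally show ?thesis .
qed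

text \<open>The base points of the lines in \<open>integral_lborel_lines\<close> have no
  \<open>b\<close>-component, so the outer integrals agree as soon as the inner ones do on lines
  through the hyperplane orthogonal to \<open>b\<close>.\<close>

lemma integral_lborel_eq_lines:
  fixes f g :: "'a::euclidean_space \<Rightarrow> real"
  assumes "integrable lborel f" "integrable lborel g" and b: "b \<in> Basis"
    and eq: "\<And>x. x \<bullet> b = 0 \<Longrightarrow>
      (\<integral>y. f (x + y *\<^sub>R b) \<partial>lborel) = (\<integral>y. g (x + y *\<^sub>R b) \<partial>lborel)"
  shows "integral\<^sup>L lborel f = integral\<^sup>L lborel g"
proof -
  have "(\<Sum>c\<in>Basis - {b}. h c *\<^sub>R c) \<bullet> b = 0" for h :: "'a \<Rightarrow> real"
    using b by (auto simp: inner_sum_left inner_Basis intro!: sum.neutral)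
  then show ?thesis
    using assms by (simp add: integral_lborel_lines)
qed

definition line_cell :: "domain \<Rightarrow> real set" where
  "line_cell \<Omega> = (case \<Omega> of Whole_Space \<Rightarrow> UNIV | Torus \<Rightarrow> {0..<1})"

text \<open>The fundamental theorem of calculus is applied on closed intervals, while the torus cell
  is half open; the missing endpoint is a null set.\<close>

lemma integral_atLeastLessThan:
  fixes f :: "real \<Rightarrow> real"
  assumes "continuous_on {a..b} f"
  shows "(LINT y:{a..<b}|lborel. f y) = (LINT y:{a..b}|lborel. f y)"
proof (rule set_integral_cong_set)
  show "AE y in lborel. y \<in> {a..b} \<longleftrightarrow> y \<in> {a..<b}"
    using AE_lborel_singleton[of b] by eventually_elim auto
  show "set_borel_measurable lborel {a..<b} f" "set_borel_measurable lborel {a..b} f"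
    unfolding set_borel_measurable_def
    by (auto intro!: borel_measurable_continuous_on_indicator continuous_on_subset[OF assms]
      simp del: real_scaleR_def)
qed

text \<open>What remains is a difference of boundary values: both are 0 beyond the support in the
  whole space, and they cancel by periodicity on the torus.\<close>

lemma integral_line_cell_deriv:
  assumes deriv: "\<And>y. (h has_real_derivative h' y) (at y)"
    and cont: "continuous_on UNIV h'"
    and per: "fun_on \<Omega> h"
    and supp: "\<And>y. \<Omega> = Whole_Space \<Longrightarrow> R < \<bar>y\<bar> \<Longrightarrow> h y = 0"
  shows "(LINT y:line_cell \<Omega>|lborel. h' y) = 0"
proof -
  have vd: "(h has_vector_derivative h' y) (at y within S)" for y S
    using deriv[of y] by (simp add: has_real_derivative_iff_has_vector_derivative has_vector_derivative_at_within)
  have FTC: "(LINT y:{a..b}|lborel. h' y) = h b - h a" if "a \<le> b" for a b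
    unfolding set_lebesgue_integral_def
    using integral_FTC_Icc[OF that vd continuous_on_subset[OF cont subset_UNIV]] by simp
  show ?thesis
  proof (cases \<Omega>)
    case Whole_Space
    have h'0: "h' y = 0" if "\<bar>R\<bar> < \<bar>y\<bar>" for y
    proof -
      have "(h has_real_derivative 0) (at y)"
      proof (rule DERIV_cong_ev[THEN iffD2, OF refl _ refl, of _ "\<lambda>_. 0"])
        have "\<forall>\<^sub>F z in nhds y. z \<in> {z. \<bar>R\<bar> < \<bar>z\<bar>}"
          using that by (intro eventually_nhds_in_open open_Collect_less continuous_intros) auto
        then show "\<forall>\<^sub>F z in nhds y. h z = 0"
          by eventually_elim (use Whole_Space supp in auto)
      qed simp
      with deriv show ?thesis
        using DERIV_unique by blast
    qed
    \<comment> \<open>\<open>R\<close> may be negative: the absolute value makes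
      \<open>{-?r..?r}\<close> a genuine interval, and the summand 1 puts its endpoints where
      \<open>h\<close> is known to vanish.\<close>
    let ?r = "\<bar>R\<bar> + 1"
    have "(LINT y:line_cell \<Omega>|lborel. h' y) = (LINT y:{-?r..?r}|lborel. h' y)"
      unfolding set_lebesgue_integral_def line_cell_def
      by (intro Bochner_Integration.integral_cong) (auto simp: Whole_Space indicator_def intro!: h'0)
    also have "\<dots> = 0"
      using FTC[of "-?r" ?r] supp[OF Whole_Space, of ?r] supp[OF Whole_Space, of "-?r"] by simp
    finally show ?thesis .
  next
    case Torus
    then have "h (0 + 1) = h 0"
      using per unfolding fun_on_def by (metis Basis_real_def Ints_1 inner_real_def mult_1 singletonD)
    then show ?thesis
      using FTC[of 0 1] by (simp add: line_cell_def Torus integral_atLeastLessThan continuous_on_subset[OF cont])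
  qed
qed

text \<open>On the torus \<open>c\<close> need not be an integer, so the claim is that all intervals
  of length 1 give the same integral. If P is an antiderivative of \<open>h\<close>, this integral
  is P(d + 1) - P(d), whose derivative in d is h(d + 1) - h(d) = 0.\<close>

lemma integral_line_cell_shift:
  fixes h :: "real \<Rightarrow> real"
  assumes cont: "continuous_on UNIV h" and per: "fun_on \<Omega> h"
  shows "(LINT y:line_cell \<Omega>|lborel. h (y + c)) = (LINT y:line_cell \<Omega>|lborel. h y)"
proof (cases \<Omega>)
  case Whole_Space
  then show ?thesis
    using lborel_integral_real_affine[of 1 h c]
    by (simp add: line_cell_def set_lebesgue_integral_def add.commute)
next
  case Torus
  \<comment> \<open>The antiderivative is taken on a compact interval; \<open>{a..b}\<close>
    contains the periods starting at 0 and at \<open>c\<close> and all periods between them.\<close>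
  define a where "a = min 0 c"
  define b where "b = max 0 c + 1"
  have ab: "a \<le> 0" "a \<le> c" "1 \<le> b" "c + 1 \<le> b"
    unfolding a_def b_def by auto
  obtain P where P: "\<And>x. x \<in> {a..b} \<Longrightarrow> (P has_vector_derivative h x) (at x within {a..b})"
    using antiderivative_continuous continuous_on_subset[OF cont] by (metis subset_UNIV)
  have h1: "h (x + 1) = h x" for x
    using per Torus unfolding fun_on_def by (metis Basis_real_def Ints_1 inner_real_def mult_1 singletonD)
  have *: "(LINT y:{0..<1}|lborel. h (y + d)) = P (d + 1) - P d" if "a \<le> d" "d + 1 \<le> b" for d
  proof -
    have "((\<lambda>y. P (y + d)) has_vector_derivative h (y + d)) (at y within {0..1})"
      if "0 \<le> y" "y \<le> 1" for y
    proof -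
      have "(P has_vector_derivative h (y + d)) (at (y + d) within (\<lambda>y. y + d) ` {0..1})"
        by (rule has_vector_derivative_within_subset[OF P]) (use \<open>a \<le> d\<close> \<open>d + 1 \<le> b\<close> that in auto)
      moreover have "((\<lambda>y. y + d) has_vector_derivative 1) (at y within {0..1})"
        by (auto intro!: derivative_eq_intros)
      ultimately show ?thesis
        using vector_diff_chain_within by (fastforce simp: comp_def)
    qed
    then show ?thesis
      using integral_FTC_Icc[of 0 1 "\<lambda>y. P (y + d)" "\<lambda>y. h (y + d)"]
      by (subst integral_atLeastLessThan)
        (simp_all add: set_lebesgue_integral_def add.commute
          continuous_on_compose2[OF cont] continuous_intros)
  qed
  have "\<exists>K. \<forall>d\<in>{a..b - 1}. P (d + 1) - P d = K"
  proof (rule has_vector_derivative_zero_constant)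
    show "convex {a..b - 1}" by simp
    fix d assume d: "d \<in> {a..b - 1}"
    have "(P has_vector_derivative h (d + 1)) (at (d + 1) within (\<lambda>y. y + 1) ` {a..b - 1})"
      by (rule has_vector_derivative_within_subset[OF P]) (use d ab in auto)
    moreover have "((\<lambda>y. y + 1) has_vector_derivative 1) (at d within {a..b - 1})"
      by (auto intro!: derivative_eq_intros)
    ultimately have 1: "((\<lambda>d. P (d + 1)) has_vector_derivative h d) (at d within {a..b - 1})"
      using vector_diff_chain_within by (fastforce simp: comp_def h1)
    have 2: "(P has_vector_derivative h d) (at d within {a..b - 1})"
      by (rule has_vector_derivative_within_subset[OF P]) (use d in auto)
    show "((\<lambda>d. P (d + 1) - P d) has_vector_derivative 0) (at d within {a..b - 1})"
      using has_vector_derivative_diff[OF 1 2] by simp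
  qed blast
  moreover have "c \<in> {a..b - 1}" "0 \<in> {a..b - 1}"
    using ab by auto
  ultimately have "P (c + 1) - P c = P (0 + 1) - P 0"
    by metis
  then show ?thesis
    using *[of c] *[of 0] ab by (simp add: line_cell_def Torus)
qed

section \<open>Integrals over the fundamental cell\<close>

lemma cell_borel [measurable]: "cell \<Omega> \<in> sets borel"
proof -
  have "{x :: real ^ 3. \<forall>i. 0 \<le> x $ i \<and> x $ i < 1} = (\<Inter>i. {x. 0 \<le> x $ i} \<inter> {x. x $ i < 1})"
    by auto
  also have "\<dots> \<in> sets borel"
    by (intro sets.countable_INT' sets.Int borel_closed borel_open closed_Collect_le open_Collect_less
      continuous_intros) auto
  finally show ?thesis
    by (simp add: cell_def split: domain.split)
qed

lemma norm_cell_Torus: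
  assumes "x \<in> cell Torus"
  shows "norm x \<le> 3"
proof -
  have "0 \<le> x $ i" "x $ i < 1" for i
    using assms by (auto simp: cell_def)
  then have "(\<Sum>i\<in>UNIV. \<bar>x $ i\<bar>) \<le> (\<Sum>i\<in>(UNIV :: 3 set). 1)"
    by (intro sum_mono) (simp add: abs_le_iff less_imp_le)
  then show ?thesis
    using norm_le_l1_cart[of x] by simp
qed

lemma in_cell_line:
  assumes "x $ i = 0"
  shows "x + y *\<^sub>R axis i 1 \<in> cell \<Omega> \<longleftrightarrow>
    y \<in> line_cell \<Omega> \<and> (\<Omega> = Torus \<longrightarrow> (\<forall>j. j \<noteq> i \<longrightarrow> 0 \<le> x $ j \<and> x $ j < 1))"
  using assms
  by (cases \<Omega>) (auto simp: cell_def line_cell_def axis_def split: if_splits)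

lemma integral_cell_eq_lines:
  fixes f g :: "real ^ 3 \<Rightarrow> real"
  assumes f: "set_integrable lborel (cell \<Omega>) f" and g: "set_integrable lborel (cell \<Omega>) g"
    and eq: "\<And>x. x $ i = 0 \<Longrightarrow>
      (LINT y:line_cell \<Omega>|lborel. f (x + y *\<^sub>R axis i 1)) =
      (LINT y:line_cell \<Omega>|lborel. g (x + y *\<^sub>R axis i 1))"
  shows "(LINT x:cell \<Omega>|lborel. f x) = (LINT x:cell \<Omega>|lborel. g x)"
  unfolding set_lebesgue_integral_def
proof (rule integral_lborel_eq_lines[of _ _ "axis i 1"])
  show "integrable lborel (\<lambda>x. indicator (cell \<Omega>) x *\<^sub>R f x)"
    "integrable lborel (\<lambda>x. indicator (cell \<Omega>) x *\<^sub>R g x)"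
    using f g by (auto simp: set_integrable_def)
  show "axis i (1::real) \<in> Basis"
    by (simp add: axis_in_Basis_iff)
  fix x :: "real ^ 3"
  assume "x \<bullet> axis i 1 = 0"
  then have x: "x $ i = 0"
    by (simp add: inner_axis)
  \<comment> \<open>A line either misses the cell or meets it in a copy of
    \<open>line_cell \<Omega>\<close>. Which of the two happens depends on the base point only, so
    the factor \<open>p\<close> comes out of the line integral.\<close>
  define p :: real where
    "p = indicator {x. \<Omega> = Torus \<longrightarrow> (\<forall>j. j \<noteq> i \<longrightarrow> 0 \<le> x $ j \<and> x $ j < 1)} x"
  have "(LINT y|lborel. indicator (cell \<Omega>) (x + y *\<^sub>R axis i 1) *\<^sub>R h (x + y *\<^sub>R axis i 1)) =
    p * (LINT y:line_cell \<Omega>|lborel. h (x + y *\<^sub>R axis i 1))" for h :: "real ^ 3 \<Rightarrow> real"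
    unfolding set_lebesgue_integral_def integral_mult_right_zero[symmetric]
    by (intro Bochner_Integration.integral_cong) (auto simp: p_def indicator_def in_cell_line[of x i, OF x])
  then show "(LINT y|lborel. indicator (cell \<Omega>) (x + y *\<^sub>R axis i 1) *\<^sub>R f (x + y *\<^sub>R axis i 1)) =
    (LINT y|lborel. indicator (cell \<Omega>) (x + y *\<^sub>R axis i 1) *\<^sub>R g (x + y *\<^sub>R axis i 1))"
    using eq[OF x] by simp
qed

lemma fun_on_line:
  fixes w :: "real ^ 3 \<Rightarrow> real"
  assumes "fun_on \<Omega> w"
  shows "fun_on \<Omega> (\<lambda>y::real. w (x + y *\<^sub>R axis i 1))"
  unfolding fun_on_def
proof (intro impI allI)
  fix y k :: real
  assume T: "\<Omega> = Torus" and k: "\<forall>b\<in>Basis. k \<bullet> b \<in> \<int>"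
  then have "\<forall>b\<in>Basis. (k *\<^sub>R axis i (1::real) :: real ^ 3) \<bullet> b \<in> \<int>"
    by (auto simp: Basis_vec_def inner_axis_axis)
  then have "w ((x + y *\<^sub>R axis i 1) + k *\<^sub>R axis i 1) = w (x + y *\<^sub>R axis i 1)"
    using assms T unfolding fun_on_def by blast
  then show "w (x + (y + k) *\<^sub>R axis i 1) = w (x + y *\<^sub>R axis i 1)"
    by (simp add: algebra_simps)
qed

text \<open>As \<open>c\<close> is constant in direction \<open>i\<close>, every line is moved
  rigidly, and periodicity of \<open>w\<close> makes up for what leaves the torus cell.
  \<open>c\<close> carries no measurability assumption, so integrability of the shifted function is
  a hypothesis of its own.\<close>

lemma integral_cell_shift:
  fixes w c :: "real ^ 3 \<Rightarrow> real"
  assumes cont: "continuous_on UNIV w" and per: "fun_on \<Omega> w"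
    and c: "\<And>x y. c (x + y *\<^sub>R axis i 1) = c x"
    and int: "set_integrable lborel (cell \<Omega>) w"
      "set_integrable lborel (cell \<Omega>) (\<lambda>x. w (x + c x *\<^sub>R axis i 1))"
  shows "(LINT x:cell \<Omega>|lborel. w (x + c x *\<^sub>R axis i 1)) = (LINT x:cell \<Omega>|lborel. w x)"
proof (rule integral_cell_eq_lines[OF int(2,1)])
  fix x :: "real ^ 3"
  have "continuous_on UNIV (\<lambda>y. w (x + y *\<^sub>R axis i 1))"
    by (intro continuous_on_compose2[OF cont] continuous_intros) auto
  from integral_line_cell_shift[OF this fun_on_line[OF per], of "c x"]
  show "(LINT y:line_cell \<Omega>|lborel. w (x + y *\<^sub>R axis i 1 + c (x + y *\<^sub>R axis i 1) *\<^sub>R axis i 1)) =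
    (LINT y:line_cell \<Omega>|lborel. w (x + y *\<^sub>R axis i 1))"
    by (simp add: c algebra_simps)
qed

text \<open>Integration by parts that never differentiates \<open>c\<close>: being constant along
  the lines of differentiation, it factors out of each line integral and leaves the integral of a
  derivative.\<close>

lemma integral_cell_deriv:
  fixes \<psi> c D :: "real ^ 3 \<Rightarrow> real"
  assumes deriv: "\<And>x y. ((\<lambda>y. \<psi> (x + y *\<^sub>R axis i 1)) has_real_derivative D (x + y *\<^sub>R axis i 1)) (at y)"
    and cont: "continuous_on UNIV D"
    and per: "fun_on \<Omega> \<psi>"
    and supp: "\<And>x. \<Omega> = Whole_Space \<Longrightarrow> R < norm x \<Longrightarrow> \<psi> x = 0"
    and c: "\<And>x y. c (x + y *\<^sub>R axis i 1) = c x"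
    and int: "set_integrable lborel (cell \<Omega>) (\<lambda>x. c x * D x)"
  shows "(LINT x:cell \<Omega>|lborel. c x * D x) = 0"
proof -
  have "(LINT x:cell \<Omega>|lborel. c x * D x) = (LINT x:cell \<Omega>|lborel. 0)"
  proof (rule integral_cell_eq_lines[OF int])
    show "set_integrable lborel (cell \<Omega>) (\<lambda>x. 0::real)"
      by (simp add: set_integrable_def)
    fix x :: "real ^ 3"
    assume x: "x $ i = 0"
    have "(LINT y:line_cell \<Omega>|lborel. D (x + y *\<^sub>R axis i 1)) = 0"
    proof (rule integral_line_cell_deriv[OF deriv _ fun_on_line[OF per], of _ R])
      show "continuous_on UNIV (\<lambda>y. D (x + y *\<^sub>R axis i 1))"
        by (intro continuous_on_compose2[OF cont] continuous_intros) auto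
      \<comment> \<open>The base point has \<open>i\<close>-th coordinate 0, so \<open>y\<close> is
        a coordinate of the point and \<open>\<bar>y\<bar>\<close> bounds its norm from
        below.\<close>
      show "\<psi> (x + y *\<^sub>R axis i 1) = 0" if "\<Omega> = Whole_Space" "R < \<bar>y\<bar>" for y
        using component_le_norm_cart[of "x + y *\<^sub>R axis i 1" i] that x
        by (intro supp) (auto simp: axis_def)
    qed
    then show "(LINT y:line_cell \<Omega>|lborel. c (x + y *\<^sub>R axis i 1) * D (x + y *\<^sub>R axis i 1)) =
      (LINT y:line_cell \<Omega>|lborel. 0)"
      by (simp add: c)
  qed
  then show ?thesis
    by simp
qed

section \<open>Integrability and Fubini on cells\<close>

lemma set_integrable_lborel_support:
  fixes F :: "'a::euclidean_space \<Rightarrow> real"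
  assumes cont: "continuous_on K F" and K: "compact K" and A: "A \<in> sets borel"
    and supp: "\<And>z. z \<in> A - K \<Longrightarrow> F z = 0"
  shows "set_integrable lborel A F"
proof -
  have "integrable lborel (\<lambda>z. indicator A z *\<^sub>R (indicator K z *\<^sub>R F z))"
    using A by (intro integrable_mult_indicator borel_integrable_compact K cont) auto
  also have "(\<lambda>z. indicator A z *\<^sub>R (indicator K z *\<^sub>R F z)) = (\<lambda>z. indicator A z *\<^sub>R F z)"
    using supp by (fastforce simp: indicator_def)
  finally show ?thesis
    by (simp add: set_integrable_def)
qed

lemma set_integrable_cell:
  fixes w :: "real ^ 3 \<Rightarrow> real"
  assumes "continuous_on UNIV w" "\<And>x. \<Omega> = Whole_Space \<Longrightarrow> R < norm x \<Longrightarrow> w x = 0"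
  shows "set_integrable lborel (cell \<Omega>) w"
\<comment> \<open>One radius for both domains: 3 covers the torus cell, where \<open>w\<close> need
  not vanish anywhere, and \<open>R\<close> covers the support in the whole space.\<close>
proof (rule set_integrable_lborel_support[where K = "cball 0 (max 3 R)"])
  show "w x = 0" if "x \<in> cell \<Omega> - cball 0 (max 3 R)" for x
    using that norm_cell_Torus[of x] assms(2)[of x] by (cases \<Omega>) auto
  show "continuous_on (cball 0 (max 3 R)) w"
    using assms(1) continuous_on_subset by blast
qed auto

text \<open>Supports are tracked on the covering space, where a nonzero periodic function is never
  compactly supported; hence only time is bounded for the torus. The set is closed, so that
  derivatives vanish off it together with the function.\<close>

definition supp_box :: "domain \<Rightarrow> real \<Rightarrow> ((real ^ 3) \<times> real) set" where
  "supp_box \<Omega> R = {z. snd z \<le> R \<and> (\<Omega> = Whole_Space \<longrightarrow> norm (fst z) \<le> R)}"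

lemma closed_supp_box: "closed (supp_box \<Omega> R)"
  unfolding supp_box_def by (cases \<Omega>) (auto intro!: closed_Collect_conj closed_Collect_le continuous_intros)

lemma set_integrable_spacetime_cell:
  fixes F :: "(real ^ 3) \<times> real \<Rightarrow> real"
  assumes cont: "continuous_on spacetime F"
    and supp: "\<And>z. z \<in> spacetime - supp_box \<Omega> R \<Longrightarrow> F z = 0"
  shows "set_integrable lborel (cell \<Omega> \<times> {0..}) F"
proof (rule set_integrable_lborel_support[where K = "cball 0 (max 3 R) \<times> {0..R}"])
  show "continuous_on (cball 0 (max 3 R) \<times> {0..R}) F"
    by (rule continuous_on_subset[OF cont]) (auto simp: spacetime_def)
  show "compact (cball (0 :: real ^ 3) (max 3 R) \<times> {0..R})"
    by (intro compact_Times) auto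
  show "cell \<Omega> \<times> {0::real..} \<in> sets borel"
    by (subst borel_prod[symmetric]) (intro pair_measureI cell_borel, simp)
  show "F z = 0" if "z \<in> cell \<Omega> \<times> {0..} - cball 0 (max 3 R) \<times> {0..R}" for z
    using that norm_cell_Torus[of "fst z"]
    by (intro supp; cases \<Omega>; cases z) (auto simp: spacetime_def supp_box_def)
qed

lemma set_integral_lborel_Times:
  fixes F :: "'a::euclidean_space \<times> 'b::euclidean_space \<Rightarrow> real"
  assumes "set_integrable lborel (A \<times> B) F"
  shows "(LINT z:A \<times> B|lborel. F z) = (LINT x:A|lborel. (LINT t:B|lborel. F (x, t)))" (is ?fst)
    and "(LINT z:A \<times> B|lborel. F z) = (LINT t:B|lborel. (LINT x:A|lborel. F (x, t)))" (is ?snd)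
proof -
  have int: "integrable (lborel \<Otimes>\<^sub>M lborel) (\<lambda>(x, t). indicator (A \<times> B) (x, t) *\<^sub>R F (x, t))"
    using assms by (simp add: set_integrable_def lborel_prod case_prod_unfold)
  have eq: "(LINT z:A \<times> B|lborel. F z) =
      integral\<^sup>L (lborel \<Otimes>\<^sub>M lborel) (\<lambda>(x, t). indicator (A \<times> B) (x, t) *\<^sub>R F (x, t))"
    by (simp add: set_lebesgue_integral_def lborel_prod case_prod_unfold)
  show ?fst
    unfolding eq lborel_pair.integral_fst[OF int, symmetric]
    by (simp add: set_lebesgue_integral_def indicator_times mult.assoc
      flip: integral_mult_right_zero)
  show ?snd
    unfolding eq lborel_pair.integral_snd[OF int, symmetric]
    by (simp add: set_lebesgue_integral_def indicator_times mult_ac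
      flip: integral_mult_right_zero)
qed

text \<open>The weak formulation integrates over \<open>lebesgue\<close>, but the product structure
  behind Fubini belongs to \<open>lborel\<close>. Completing a measure does not change integrals of
  functions that were already measurable.\<close>

lemma set_integral_lebesgue_lborel:
  fixes f :: "'a::euclidean_space \<Rightarrow> real"
  assumes "set_integrable lborel A f"
  shows "set_lebesgue_integral lebesgue A f = set_lebesgue_integral lborel A f"
  using assms unfolding set_lebesgue_integral_def set_integrable_def
  by (intro integral_completion) auto

section \<open>Test functions\<close>

text \<open>A derivative within a set is determined if arbitrarily short steps in every basis
  direction stay in the set, which is true of \<open>spacetime\<close> even on its boundary.\<close>

lemma frechet_derivative_spacetime_eqI:
  fixes \<psi> :: "(real ^ 3) \<times> real \<Rightarrow> real"
  assumes "(\<psi> has_derivative D) (at z within spacetime)" "z \<in> spacetime"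
  shows "frechet_derivative \<psi> (at z within spacetime) = D"
proof (rule frechet_derivative_unique_within)
  show "(\<psi> has_derivative frechet_derivative \<psi> (at z within spacetime)) (at z within spacetime)"
    using assms(1) by (auto simp: differentiable_def simp flip: frechet_derivative_works)
  \<comment> \<open>The step \<open>e / 2\<close> is positive, hence goes forward in time and is
    admissible also at time 0.\<close>
  show "\<exists>d. 0 < \<bar>d\<bar> \<and> \<bar>d\<bar> < e \<and> z + d *\<^sub>R i \<in> spacetime"
    if "i \<in> Basis" "0 < e" for i :: "(real ^ 3) \<times> real" and e :: real
    using assms(2) that
    by (intro exI[of _ "e / 2"]) (auto simp: spacetime_def Basis_prod_def mem_Times_iff)
qed fact

lemma partial_deriv_spacetime_zero:
  fixes \<psi> :: "(real ^ 3) \<times> real \<Rightarrow> real"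
  assumes zero: "\<And>z. z \<in> spacetime - B \<Longrightarrow> \<psi> z = 0" and "closed B" and z: "z \<in> spacetime - B"
  shows "partial_deriv spacetime b \<psi> z = 0"
proof -
  have "(\<psi> has_derivative (\<lambda>_. 0)) (at z within spacetime)"
  proof (rule has_derivative_transform_eventually[of "\<lambda>_. 0"])
    show "\<forall>\<^sub>F z in at z within spacetime. 0 = \<psi> z"
      unfolding eventually_at_topological
      using z zero \<open>closed B\<close> by (intro exI[of _ "- B"]) auto
  qed (use z zero in auto)
  then show ?thesis
    using frechet_derivative_spacetime_eqI z by (fastforce simp: partial_deriv_def)
qed

lemma test_fun_differentiable:
  assumes "test_fun \<Omega> \<psi>" "z \<in> spacetime"
  shows "(\<psi> has_derivative frechet_derivative \<psi> (at z within spacetime)) (at z within spacetime)"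
proof -
  have "Ck_on (Suc 0) spacetime \<psi>"
    using assms unfolding test_fun_def Cinf_on_def by blast
  with assms show ?thesis
    by (auto simp: differentiable_on_def simp flip: frechet_derivative_works)
qed

lemma test_fun_continuous:
  "test_fun \<Omega> \<psi> \<Longrightarrow> continuous_on spacetime \<psi>"
  by (auto simp: test_fun_def Cinf_on_def dest: spec[of _ 0])

lemma test_fun_partial_deriv_continuous:
  assumes "test_fun \<Omega> \<psi>" "b \<in> Basis"
  shows "continuous_on spacetime (partial_deriv spacetime b \<psi>)"
proof -
  have "Ck_on (Suc 0) spacetime \<psi>"
    using assms unfolding test_fun_def Cinf_on_def by blast
  with assms show ?thesis
    by auto
qed

lemma test_fun_fun_on: "test_fun \<Omega> \<psi> \<Longrightarrow> 0 \<le> t \<Longrightarrow> fun_on \<Omega> (\<lambda>x. \<psi> (x, t))"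
  by (simp add: test_fun_def)

lemma spacetime_Basis [simp]:
  "(axis i (1::real), 0::real) \<in> Basis" "(0 :: real ^ 3, 1::real) \<in> Basis"
  by (auto simp: Basis_prod_def axis_in_Basis_iff)

text \<open>Integer translations in space map \<open>spacetime\<close> into itself, so the
  derivative at the translated point also serves at the original one, and uniqueness identifies the
  two.\<close>

lemma fun_on_partial_deriv_spacetime:
  assumes \<psi>: "test_fun \<Omega> \<psi>" and "0 \<le> t"
  shows "fun_on \<Omega> (\<lambda>x. partial_deriv spacetime b \<psi> (x, t))"
  unfolding fun_on_def
proof (intro impI allI)
  fix x k :: "real ^ 3"
  assume T: "\<Omega> = Torus" and k: "\<forall>b\<in>Basis. k \<bullet> b \<in> \<int>"
  let ?D = "frechet_derivative \<psi> (at (x + k, t) within spacetime)"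
  have per: "\<psi> (z + (k, 0)) = \<psi> z" if "z \<in> spacetime" for z
    using test_fun_fun_on[OF \<psi>, of "snd z"] that T k
    by (cases z) (auto simp: fun_on_def spacetime_def)
  have xt: "(x, t) \<in> spacetime" "(x + k, t) \<in> spacetime"
    using \<open>0 \<le> t\<close> by (auto simp: spacetime_def)
  have "((\<lambda>z. \<psi> (z + (k, 0))) has_derivative ?D) (at (x, t) within spacetime)"
  proof (rule has_derivative_in_compose[where g = \<psi> and f = "\<lambda>z. z + (k, 0)"])
    show "((\<lambda>z. z + (k, 0)) has_derivative (\<lambda>z. z)) (at (x, t) within spacetime)"
      by (auto intro!: derivative_eq_intros)
    show "(\<psi> has_derivative ?D) (at ((x, t) + (k, 0)) within (\<lambda>z. z + (k, 0)) ` spacetime)"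
    proof -
      have "(\<psi> has_derivative ?D) (at (x + k, t) within (\<lambda>z. z + (k, 0)) ` spacetime)"
        by (rule has_derivative_subset[OF test_fun_differentiable[OF \<psi> xt(2)]])
          (auto simp: spacetime_def)
      then show ?thesis
        by simp
    qed
  qed
  then have "(\<psi> has_derivative ?D) (at (x, t) within spacetime)"
    by (rule has_derivative_transform[rotated 2]) (use xt per in auto)
  then show "partial_deriv spacetime b \<psi> (x + k, t) = partial_deriv spacetime b \<psi> (x, t)"
    using frechet_derivative_spacetime_eqI xt by (simp add: partial_deriv_def)
qed

lemma translate_into_cell_Torus:
  fixes x :: "real ^ 3"
  obtains k where "\<forall>b\<in>Basis. k \<bullet> b \<in> \<int>" "x + k \<in> cell Torus"
proof
  show "\<forall>b\<in>Basis. (\<chi> i. - real_of_int \<lfloor>x $ i\<rfloor>) \<bullet> b \<in> \<int>"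
    by (auto simp: Basis_vec_def inner_axis Basis_real_def)
  show "x + (\<chi> i. - real_of_int \<lfloor>x $ i\<rfloor>) \<in> cell Torus"
    by (auto simp: cell_def) linarith+
qed

text \<open>The definition bounds the support only over the cell. On the torus an integer
  translation brings any point into the cell without changing its time, so the bound on time carries
  over to the covering space.\<close>

lemma test_fun_support:
  assumes "test_fun \<Omega> \<psi>"
  obtains R where "0 \<le> R" "\<And>z. z \<in> spacetime - supp_box \<Omega> R \<Longrightarrow> \<psi> z = 0"
proof -
  obtain R where R: "0 < R" "\<And>z. z \<in> cell \<Omega> \<times> {0..} \<Longrightarrow> \<psi> z \<noteq> 0 \<Longrightarrow> norm z \<le> R"
    using assms unfolding test_fun_def bounded_pos by blast
  show ?thesis
  proof
    fix z :: "(real ^ 3) \<times> real"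
    assume z: "z \<in> spacetime - supp_box \<Omega> R"
    obtain x t where xt: "z = (x, t)" "0 \<le> t"
      using z by (cases z) (auto simp: spacetime_def)
    show "\<psi> z = 0"
    proof (cases \<Omega>)
      case Whole_Space
      then show ?thesis
        using R(2)[of z] z xt norm_fst_le[of x t] norm_snd_le[of t x]
        by (force simp: supp_box_def cell_def)
    next
      case Torus
      obtain k where k: "\<forall>b\<in>Basis. k \<bullet> b \<in> \<int>" "x + k \<in> cell Torus"
        using translate_into_cell_Torus .
      have "\<psi> (x + k, t) = 0"
        using R(2)[of "(x + k, t)"] z xt k Torus norm_snd_le[of t "x + k"]
        by (auto simp: supp_box_def)
      then show ?thesis
        using test_fun_fun_on[OF assms xt(2)] k Torus by (auto simp: fun_on_def xt)
    qed
  qed (use R in simp)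
qed

text \<open>At a fixed time the whole spatial line lies in \<open>spacetime\<close>, so the
  derivative in \<open>y\<close> is two-sided even at time 0.\<close>

lemma test_fun_has_derivative_axis:
  assumes \<psi>: "test_fun \<Omega> \<psi>" and "0 \<le> t"
  shows "((\<lambda>y. \<psi> (x + y *\<^sub>R axis i 1, t)) has_real_derivative dx i \<psi> (x + y *\<^sub>R axis i 1, t)) (at y)"
proof -
  let ?D = "frechet_derivative \<psi> (at (x + y *\<^sub>R axis i 1, t) within spacetime)"
  have st: "(x + y *\<^sub>R axis i 1, t) \<in> spacetime" for y
    using \<open>0 \<le> t\<close> by (simp add: spacetime_def)
  note D = test_fun_differentiable[OF \<psi> st]
  have "((\<lambda>y. \<psi> (x + y *\<^sub>R axis i 1, t)) has_derivative (\<lambda>s. ?D (s *\<^sub>R axis i 1, 0))) (at y)"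
  proof (rule has_derivative_in_compose[where g = \<psi> and f = "\<lambda>y. (x + y *\<^sub>R axis i 1, t)"])
    show "((\<lambda>y. (x + y *\<^sub>R axis i 1, t)) has_derivative (\<lambda>s. (s *\<^sub>R axis i 1, 0))) (at y)"
      by (auto intro!: derivative_eq_intros)
    show "(\<psi> has_derivative ?D) (at (x + y *\<^sub>R axis i 1, t) within range (\<lambda>y. (x + y *\<^sub>R axis i 1, t)))"
      by (rule has_derivative_subset[OF D]) (use st in auto)
  qed
  moreover have "?D (s *\<^sub>R axis i 1, 0) = s * dx i \<psi> (x + y *\<^sub>R axis i 1, t)" for s
  proof -
    have "?D (s *\<^sub>R axis i 1, 0) = ?D (s *\<^sub>R (axis i 1, 0))"
      by simp
    also have "\<dots> = s * ?D (axis i 1, 0)"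
      by (simp only: linear_scale[OF has_derivative_linear[OF D]] real_scaleR_def)
    finally show ?thesis
      by (simp add: partial_deriv_def)
  qed
  ultimately show ?thesis
    by (simp add: has_field_derivative_def mult_commute_abs)
qed

text \<open>Chain rule along the characteristic of speed \<open>c\<close>. It is later applied with
  \<open>c\<close> equal to \<open>v x\<close>, which stays the same along the line. Restricting to
  \<open>{0..b}\<close> keeps the curve inside \<open>spacetime\<close>.\<close>

lemma test_fun_has_derivative_characteristic:
  assumes \<psi>: "test_fun \<Omega> \<psi>" and "0 \<le> t"
  shows "((\<lambda>s. \<psi> (x + (s * c) *\<^sub>R axis i 1, s)) has_vector_derivative
    dt \<psi> (x + (t * c) *\<^sub>R axis i 1, t) + c * dx i \<psi> (x + (t * c) *\<^sub>R axis i 1, t)) (at t within {0..b})"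
proof -
  let ?z = "\<lambda>s. (x + (s * c) *\<^sub>R axis i 1, s)"
  let ?D = "frechet_derivative \<psi> (at (?z t) within spacetime)"
  have st: "?z s \<in> spacetime" if "0 \<le> s" for s
    using that by (simp add: spacetime_def)
  note D = test_fun_differentiable[OF \<psi> st[OF \<open>0 \<le> t\<close>]]
  have "((\<lambda>s. \<psi> (?z s)) has_derivative (\<lambda>s. ?D ((s * c) *\<^sub>R axis i 1, s))) (at t within {0..b})"
  proof (rule has_derivative_in_compose[where f = ?z])
    show "(?z has_derivative (\<lambda>s. ((s * c) *\<^sub>R axis i 1, s))) (at t within {0..b})"
      by (auto intro!: derivative_eq_intros)
    show "(\<psi> has_derivative ?D) (at (?z t) within ?z ` {0..b})"
      by (rule has_derivative_subset[OF D]) (use st in auto)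
  qed
  moreover have "?D ((s * c) *\<^sub>R axis i 1, s) =
      s * (dt \<psi> (?z t) + c * dx i \<psi> (?z t))" for s
  proof -
    have "?D ((s * c) *\<^sub>R axis i 1, s) = ?D (s *\<^sub>R (0, 1) + (s * c) *\<^sub>R (axis i 1, 0))"
      by simp
    also have "\<dots> = s * ?D (0, 1) + (s * c) * ?D (axis i 1, 0)"
      by (simp only: linear_add[OF has_derivative_linear[OF D]]
        linear_scale[OF has_derivative_linear[OF D]] real_scaleR_def)
    finally show ?thesis
      by (simp add: partial_deriv_def algebra_simps)
  qed
  ultimately show ?thesis
    by (simp add: has_vector_derivative_def)
qed

section \<open>Shear flows as weak solutions\<close>

lemma fun_on_shear:
  fixes W v :: "real ^ 3 \<Rightarrow> real"
  assumes W: "fun_on \<Omega> W" and v: "fun_on \<Omega> v"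
  shows "fun_on \<Omega> (\<lambda>x. W (x + (s * v x) *\<^sub>R e))"
  unfolding fun_on_def
proof (intro impI allI)
  fix x k :: "real ^ 3"
  assume T: "\<Omega> = Torus" and k: "\<forall>b\<in>Basis. k \<bullet> b \<in> \<int>"
  have "W (x + k + (s * v (x + k)) *\<^sub>R e) = W ((x + (s * v x) *\<^sub>R e) + k)"
  proof -
    have "v (x + k) = v x"
      using v T k unfolding fun_on_def by blast
    then show ?thesis
      by (simp add: add_ac)
  qed
  also have "\<dots> = W (x + (s * v x) *\<^sub>R e)"
    using W T k unfolding fun_on_def by blast
  finally show "W (x + k + (s * v (x + k)) *\<^sub>R e) = W (x + (s * v x) *\<^sub>R e)" .
qed

text \<open>\<open>F\<close> is the profile \<open>W\<close> carried by the flow times the transport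
  derivative of \<open>\<psi>\<close>. In coordinates moving with the flow the first factor no
  longer depends on time and the second is a total time derivative, so integrating in time first
  leaves only the contribution of time 0.\<close>

lemma transport_weak:
  fixes W v :: "real ^ 3 \<Rightarrow> real"
  assumes \<psi>: "test_fun \<Omega> \<psi>"
    and W: "continuous_on UNIV W" "fun_on \<Omega> W"
    and v: "continuous_on UNIV v" "fun_on \<Omega> v" "\<And>x. \<bar>v x\<bar> \<le> B"
    and v_line: "\<And>x y. v (x + y *\<^sub>R axis i 1) = v x"
  defines "F \<equiv> \<lambda>z. W (fst z + (- snd z * v (fst z)) *\<^sub>R axis i 1) * (dt \<psi> z + v (fst z) * dx i \<psi> z)"
  shows "set_integrable lborel (cell \<Omega> \<times> {0..}) F"
    and "(LINT z:cell \<Omega> \<times> {0..}|lborel. F z) = - (LINT x:cell \<Omega>|lborel. W x * \<psi> (x, 0))"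
proof -
  \<comment> \<open>\<open>X\<close> gives the position at time \<open>snd z\<close> of the particle
    starting at \<open>fst z\<close>, and \<open>G\<close> is \<open>F\<close> pulled back along
    it.\<close>
  define X where "X z = fst z + (snd z * v (fst z)) *\<^sub>R axis i 1" for z :: "(real ^ 3) \<times> real"
  define G where "G z = W (fst z) * (dt \<psi> (X z, snd z) + v (fst z) * dx i \<psi> (X z, snd z))" for z
  obtain R where R: "0 \<le> R" and supp: "\<And>z. z \<in> spacetime - supp_box \<Omega> R \<Longrightarrow> \<psi> z = 0"
    using test_fun_support[OF \<psi>] by blast
  have outside: "(x, t) \<in> spacetime - supp_box \<Omega> r"
    if "\<Omega> = Whole_Space" "r < norm x" "0 \<le> t" for x t r
    using that by (auto simp: spacetime_def supp_box_def)
  have zero: "partial_deriv spacetime b \<psi> z = 0" if "z \<in> spacetime - supp_box \<Omega> R" for b z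
    by (rule partial_deriv_spacetime_zero[OF _ closed_supp_box that]) (rule supp)
  have "0 \<le> B"
    using v(3)[of 0] by linarith
  have contv [continuous_intros]: "continuous_on S (\<lambda>z. v (fst z))" for S :: "((real ^ 3) \<times> real) set"
    by (intro continuous_on_compose2[OF v(1)] continuous_intros) auto
  have contd: "continuous_on S (\<lambda>z. partial_deriv spacetime b \<psi> (f z, g z))"
    if "b \<in> Basis" "continuous_on S f" "continuous_on S g" "\<And>z. z \<in> S \<Longrightarrow> 0 \<le> g z"
    for S :: "'c::topological_space set" and b f g
    by (rule continuous_on_compose2[OF test_fun_partial_deriv_continuous[OF \<psi> that(1)]])
      (use that in \<open>auto simp: spacetime_def intro!: continuous_intros\<close>)
  have contF: "continuous_on spacetime F"
    unfolding F_def
    by (intro continuous_intros continuous_on_compose2[OF W(1)]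
      test_fun_partial_deriv_continuous[OF \<psi>] spacetime_Basis) auto
  show intF: "set_integrable lborel (cell \<Omega> \<times> {0..}) F"
    using contF by (rule set_integrable_spacetime_cell[of _ _ R]) (simp add: F_def zero)
  \<comment> \<open>Pulling back enlarges the support: up to time \<open>R\<close> the flow moves
    points by at most \<open>R * B\<close>.\<close>
  have suppG: "G z = 0" if "z \<in> spacetime - supp_box \<Omega> (R + R * B)" for z
  proof -
    have "(X z, snd z) \<in> spacetime - supp_box \<Omega> R"
    proof -
      have "0 \<le> snd z"
        using that by (auto simp: spacetime_def)
      have "norm (fst z) \<le> R + R * B" if "norm (X z) \<le> R" "snd z \<le> R"
      proof -
        have "norm (fst z) \<le> norm (X z) + norm ((snd z * v (fst z)) *\<^sub>R axis i (1::real) :: real ^ 3)"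
          using norm_triangle_ineq4[of "X z" "(snd z * v (fst z)) *\<^sub>R axis i 1"]
          by (simp add: X_def)
        also have "\<dots> \<le> R + R * B"
          using that \<open>0 \<le> snd z\<close> v(3)[of "fst z"] by (auto simp: abs_mult intro!: add_mono mult_mono)
        finally show ?thesis .
      qed
      moreover have "R \<le> R + R * B"
        using R \<open>0 \<le> B\<close> by simp
      ultimately show ?thesis
        using that by (auto simp: spacetime_def supp_box_def)
    qed
    then show ?thesis
      by (simp add: G_def zero)
  qed
  have contG: "continuous_on spacetime G"
    unfolding G_def X_def
    by (intro continuous_intros continuous_on_compose2[OF W(1)] contd) (auto simp: spacetime_def)
  have intG: "set_integrable lborel (cell \<Omega> \<times> {0..}) G"
    using contG suppG by (rule set_integrable_spacetime_cell)
  have shift: "(LINT x:cell \<Omega>|lborel. F (x, t)) = (LINT x:cell \<Omega>|lborel. G (x, t))" if "0 \<le> t" for t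
  proof -
    have eq: "F (x + (t * v x) *\<^sub>R axis i 1, t) = G (x, t)" for x
      by (simp add: F_def G_def X_def v_line)
    have "(LINT x:cell \<Omega>|lborel. F (x + (t * v x) *\<^sub>R axis i 1, t)) = (LINT x:cell \<Omega>|lborel. F (x, t))"
    proof (rule integral_cell_shift)
      show "continuous_on UNIV (\<lambda>x. F (x, t))"
        by (rule continuous_on_compose2[OF contF]) (use that in \<open>auto simp: spacetime_def intro!: continuous_intros\<close>)
      then show "set_integrable lborel (cell \<Omega>) (\<lambda>x. F (x, t))"
        by (rule set_integrable_cell[of _ _ R])
          (use that in \<open>simp add: F_def zero[OF outside]\<close>)
      have "continuous_on UNIV (\<lambda>x. G (x, t))"
        by (rule continuous_on_compose2[OF contG]) (use that in \<open>auto simp: spacetime_def intro!: continuous_intros\<close>)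
      then have "set_integrable lborel (cell \<Omega>) (\<lambda>x. G (x, t))"
        by (rule set_integrable_cell[of _ _ "R + R * B"])
          (use that in \<open>simp add: suppG[OF outside]\<close>)
      then show "set_integrable lborel (cell \<Omega>) (\<lambda>x. F (x + (t * v x) *\<^sub>R axis i 1, t))"
        by (simp add: eq)
      show "fun_on \<Omega> (\<lambda>x. F (x, t))"
        using fun_on_shear[OF W(2) v(2), of "- t" "axis i 1"] v(2)
          fun_on_partial_deriv_spacetime[OF \<psi> that]
        by (auto simp: fun_on_def F_def)
      show "t * v (x + y *\<^sub>R axis i 1) = t * v x" for x y
        by (simp add: v_line)
    qed
    then show ?thesis
      by (simp add: eq)
  qed
  have FTC: "(LINT t:{0..}|lborel. G (x, t)) = - (W x * \<psi> (x, 0))" if "x \<in> cell \<Omega>" for x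
  proof -
    \<comment> \<open>Past \<open>R + R * B\<close> the integrand vanishes, so the time integral may
      be cut off there; the summand 1 makes \<open>?R\<close> exceed \<open>R\<close> strictly, so
      that \<open>\<psi>\<close> is 0 at the upper end.\<close>
    let ?R = "R + R * B + 1"
    let ?h = "\<lambda>t. dt \<psi> (X (x, t), t) + v x * dx i \<psi> (X (x, t), t)"
    have R0: "0 \<le> ?R"
      using R \<open>0 \<le> B\<close> by simp
    have "(LINT t:{0..}|lborel. G (x, t)) = (LINT t:{0..?R}|lborel. G (x, t))"
      unfolding set_lebesgue_integral_def
      by (intro Bochner_Integration.integral_cong)
        (auto simp: indicator_def spacetime_def supp_box_def intro!: suppG)
    also have "\<dots> = W x * (LINT t:{0..?R}|lborel. ?h t)"
      by (simp add: G_def)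
    also have "(LINT t:{0..?R}|lborel. ?h t) = \<psi> (X (x, ?R), ?R) - \<psi> (X (x, 0), 0)"
      unfolding set_lebesgue_integral_def
    proof (rule integral_FTC_Icc[OF R0])
      show "continuous_on {0..?R} ?h"
        unfolding X_def by (intro continuous_intros contd) auto
      show "((\<lambda>t. \<psi> (X (x, t), t)) has_vector_derivative ?h t) (at t within {0..?R})"
        if "0 \<le> t" "t \<le> ?R" for t
        using test_fun_has_derivative_characteristic[OF \<psi> that(1)] by (simp add: X_def)
    qed
    also have "\<psi> (X (x, ?R), ?R) = 0"
      using R0 R \<open>0 \<le> B\<close> by (intro supp) (auto simp: spacetime_def supp_box_def not_le add_pos_nonneg add_nonneg_pos)
    finally show ?thesis
      by (simp add: X_def)
  qed
  \<comment> \<open>Space is the inner integral while the shift is made, since it works at a fixed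
    time; the order is then exchanged because \<open>FTC\<close> works at a fixed point.\<close>
  have "(LINT z:cell \<Omega> \<times> {0..}|lborel. F z) = (LINT t:{0..}|lborel. (LINT x:cell \<Omega>|lborel. F (x, t)))"
    by (rule set_integral_lborel_Times(2)[OF intF])
  also have "\<dots> = (LINT t:{0..}|lborel. (LINT x:cell \<Omega>|lborel. G (x, t)))"
    using shift by (intro set_lebesgue_integral_cong) auto
  also have "\<dots> = (LINT x:cell \<Omega>|lborel. (LINT t:{0..}|lborel. G (x, t)))"
    using set_integral_lborel_Times[OF intG] by simp
  also have "\<dots> = (LINT x:cell \<Omega>|lborel. - (W x * \<psi> (x, 0)))"
    using FTC by (intro set_lebesgue_integral_cong) auto
  finally show "(LINT z:cell \<Omega> \<times> {0..}|lborel. F z) = - (LINT x:cell \<Omega>|lborel. W x * \<psi> (x, 0))"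
    by (simp add: set_lebesgue_integral_def)
qed

text \<open>This removes every term in which the coefficient does not vary in the direction of
  differentiation: both terms of the divergence and the momentum products with j = 3. It is
  \<open>integral_cell_deriv\<close> on each time slice.\<close>

lemma spacetime_integral_deriv:
  assumes \<psi>: "test_fun \<Omega> \<psi>" and c: "continuous_on spacetime c"
    and c_line: "\<And>x y t. c (x + y *\<^sub>R axis i 1, t) = c (x, t)"
  shows "set_integrable lborel (cell \<Omega> \<times> {0..}) (\<lambda>z. c z * dx i \<psi> z)"
    and "(LINT z:cell \<Omega> \<times> {0..}|lborel. c z * dx i \<psi> z) = 0"
proof -
  obtain R where R: "0 \<le> R" and supp: "\<And>z. z \<in> spacetime - supp_box \<Omega> R \<Longrightarrow> \<psi> z = 0"
    using test_fun_support[OF \<psi>] by blast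
  have outside: "(x, t) \<in> spacetime - supp_box \<Omega> r"
    if "\<Omega> = Whole_Space" "r < norm x" "0 \<le> t" for x t r
    using that by (auto simp: spacetime_def supp_box_def)
  have zero: "partial_deriv spacetime b \<psi> z = 0" if "z \<in> spacetime - supp_box \<Omega> R" for b z
    by (rule partial_deriv_spacetime_zero[OF _ closed_supp_box that]) (rule supp)
  have cont: "continuous_on spacetime (\<lambda>z. c z * dx i \<psi> z)"
    by (intro continuous_intros c test_fun_partial_deriv_continuous[OF \<psi>] spacetime_Basis)
  then show int: "set_integrable lborel (cell \<Omega> \<times> {0..}) (\<lambda>z. c z * dx i \<psi> z)"
    by (rule set_integrable_spacetime_cell[of _ _ R]) (simp add: zero)
  have "(LINT x:cell \<Omega>|lborel. c (x, t) * dx i \<psi> (x, t)) = 0" if "0 \<le> t" for t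
  proof (rule integral_cell_deriv[OF test_fun_has_derivative_axis[OF \<psi> that] _ test_fun_fun_on[OF \<psi> that]])
    have "continuous_on UNIV (\<lambda>x. c (x, t) * dx i \<psi> (x, t))"
      by (rule continuous_on_compose2[OF cont])
        (use that in \<open>auto simp: spacetime_def intro!: continuous_intros\<close>)
    then show "set_integrable lborel (cell \<Omega>) (\<lambda>x. c (x, t) * dx i \<psi> (x, t))"
      by (rule set_integrable_cell[of _ _ R])
        (use that in \<open>simp add: zero[OF outside]\<close>)
    show "continuous_on UNIV (\<lambda>x. dx i \<psi> (x, t))"
      by (rule continuous_on_compose2[OF test_fun_partial_deriv_continuous[OF \<psi> spacetime_Basis(1)]])
        (use that in \<open>auto simp: spacetime_def intro!: continuous_intros\<close>)
    show "\<psi> (x, t) = 0" if "\<Omega> = Whole_Space" "R < norm x" for x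
      using that \<open>0 \<le> t\<close> by (intro supp outside)
  qed (rule c_line)
  then show "(LINT z:cell \<Omega> \<times> {0..}|lborel. c z * dx i \<psi> z) = 0"
    unfolding set_integral_lborel_Times(2)[OF int]
    by (simp add: set_lebesgue_integral_def indicator_def)
      (intro integral_eq_zero_AE, auto)
qed

lemma set_integrable_initial:
  assumes \<psi>: "test_fun \<Omega> \<psi>" and W: "continuous_on UNIV W"
  shows "set_integrable lborel (cell \<Omega>) (\<lambda>x. W x * \<psi> (x, 0))"
proof -
  obtain R where R: "0 \<le> R" and supp: "\<And>z. z \<in> spacetime - supp_box \<Omega> R \<Longrightarrow> \<psi> z = 0"
    using test_fun_support[OF \<psi>] by blast
  have "continuous_on UNIV (\<lambda>x. W x * \<psi> (x, 0))"
    by (intro continuous_intros W continuous_on_compose2[OF test_fun_continuous[OF \<psi>]])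
      (auto simp: spacetime_def)
  then show ?thesis
    by (rule set_integrable_cell[of _ _ R]) (simp add: supp spacetime_def supp_box_def)
qed

text \<open>The time-independent counterpart of \<open>spacetime_integral_deriv\<close>, for the
  divergence of the initial data.\<close>

lemma space_integral_deriv:
  assumes \<psi>: "test_fun_space \<Omega> \<psi>" and c: "continuous_on UNIV c"
    and c_line: "\<And>x y. c (x + y *\<^sub>R axis i 1) = c x"
  shows "set_integrable lborel (cell \<Omega>) (\<lambda>x. c x * partial_deriv UNIV (axis i 1) \<psi> x)"
    and "(LINT x:cell \<Omega>|lborel. c x * partial_deriv UNIV (axis i 1) \<psi> x) = 0"
proof -
  let ?d = "partial_deriv UNIV (axis i 1) \<psi>"
  have "Ck_on (Suc 0) UNIV \<psi>" and per: "fun_on \<Omega> \<psi>"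
    using \<psi> unfolding test_fun_space_def Cinf_on_def by auto
  then have diff: "\<And>x. (\<psi> has_derivative frechet_derivative \<psi> (at x)) (at x)"
    and contd: "continuous_on UNIV ?d"
    by (auto simp: differentiable_on_def axis_in_Basis_iff simp flip: frechet_derivative_works)
  obtain R where R: "\<And>x. x \<in> cell \<Omega> \<Longrightarrow> \<psi> x \<noteq> 0 \<Longrightarrow> norm x \<le> R"
    using \<psi> unfolding test_fun_space_def bounded_pos by blast
  then have supp: "\<psi> x = 0" if "\<Omega> = Whole_Space" "R < norm x" for x
    using that by (force simp: cell_def)
  have deriv: "((\<lambda>y. \<psi> (x + y *\<^sub>R axis i 1)) has_real_derivative ?d (x + y *\<^sub>R axis i 1)) (at y)" for x y
  proof -
    let ?D = "frechet_derivative \<psi> (at (x + y *\<^sub>R axis i 1))"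
    have "((\<lambda>y. \<psi> (x + y *\<^sub>R axis i 1)) has_derivative (\<lambda>s. ?D (s *\<^sub>R axis i 1))) (at y)"
      by (rule has_derivative_compose[OF _ diff]) (auto intro!: derivative_eq_intros)
    moreover have "?D (s *\<^sub>R axis i 1) = s * ?d (x + y *\<^sub>R axis i 1)" for s
      by (simp add: linear_scale[OF has_derivative_linear[OF diff]] partial_deriv_def)
    ultimately show ?thesis
      by (simp add: has_field_derivative_def mult_commute_abs)
  qed
  have d0: "?d x = 0" if "\<Omega> = Whole_Space" "R < norm x" for x
  proof -
    have "(\<psi> has_derivative (\<lambda>_. 0)) (at x)"
      by (rule has_derivative_transform_within_open[of "\<lambda>_. 0" _ _ _ "- cball 0 R"])
        (use that supp in auto)
    then show ?thesis
      using has_derivative_unique[OF diff] by (fastforce simp: partial_deriv_def)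
  qed
  show int: "set_integrable lborel (cell \<Omega>) (\<lambda>x. c x * ?d x)"
    by (rule set_integrable_cell[of _ _ R]) (auto intro!: continuous_intros c contd simp: d0)
  show "(LINT x:cell \<Omega>|lborel. c x * ?d x) = 0"
    by (rule integral_cell_deriv[OF deriv contd per supp c_line int])
qed

section \<open>Periodicity, continuity and the weak formulation of shear flows\<close>

lemma fun_on_componentI:
  assumes "\<And>i. fun_on \<Omega> (\<lambda>x. u x $ i)"
  shows "fun_on \<Omega> u"
  using assms unfolding fun_on_def vec_eq_iff by blast

lemma fun_on_component:
  fixes w :: "real \<Rightarrow> real"
  assumes "fun_on \<Omega> w"
  shows "fun_on \<Omega> (\<lambda>x :: real ^ 3. w (x $ j))"
  unfolding fun_on_def
proof (intro impI allI)
  fix x k :: "real ^ 3"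
  assume T: "\<Omega> = Torus" and k: "\<forall>b\<in>Basis. k \<bullet> b \<in> \<int>"
  have "k \<bullet> axis j 1 \<in> \<int>"
    using k by (simp add: axis_in_Basis_iff)
  then show "w ((x + k) $ j) = w (x $ j)"
    using assms T by (simp add: fun_on_def inner_axis)
qed

lemma fun_on_shear_component:
  fixes w u1 :: "real \<Rightarrow> real"
  assumes w: "fun_on \<Omega> w" and u1: "fun_on \<Omega> u1"
  shows "fun_on \<Omega> (\<lambda>x :: real ^ 3. w (x $ 1 - t * u1 (x $ 2)))"
  using fun_on_shear[OF fun_on_component[OF w, of 1] fun_on_component[OF u1, of 2], of "- t" "axis 1 1"]
  by (simp add: axis_def)

lemma shear_flow_nth [simp]:
  "shear_flow u1 u3 x t $ 1 = u1 (x $ 2)"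
  "shear_flow u1 u3 x t $ 2 = 0"
  "shear_flow u1 u3 x t $ 3 = u3 (x $ 1 - t * u1 (x $ 2))"
  by (simp_all add: shear_flow_def)

lemma fun_on_shear_flow:
  assumes u1: "fun_on \<Omega> u1" and u3: "fun_on \<Omega> u3"
  shows "fun_on \<Omega> (\<lambda>x. shear_flow u1 u3 x t)"
proof (rule fun_on_componentI)
  fix i :: 3
  have "\<forall>i. fun_on \<Omega> (\<lambda>x. shear_flow u1 u3 x t $ i)"
    using fun_on_component[OF u1, of 2] fun_on_shear_component[OF u3 u1]
    by (simp add: forall_3) (simp add: fun_on_def)
  then show "fun_on \<Omega> (\<lambda>x. shear_flow u1 u3 x t $ i)"
    by blast
qed

lemma continuous_on_shear_flow:
  assumes u1: "continuous_on UNIV u1" and u3: "continuous_on UNIV u3"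
    and f: "continuous_on S f" "continuous_on S g"
  shows "continuous_on S (\<lambda>z. shear_flow u1 u3 (f z) (g z))"
proof -
  have "\<forall>i. continuous_on S (\<lambda>z. shear_flow u1 u3 (f z) (g z) $ i)"
    by (simp add: forall_3)
      (intro conjI continuous_intros continuous_on_compose2[OF u1] continuous_on_compose2[OF u3] f; simp)
  then have "continuous_on S (\<lambda>z. \<chi> i. shear_flow u1 u3 (f z) (g z) $ i)"
    by (intro continuous_on_vec_lambda) blast
  then show ?thesis
    by simp
qed

lemma L2_loc_continuous:
  assumes f: "continuous_on S f" and "closed S"
  shows "L2_loc S f"
  unfolding L2_loc_def
proof (intro conjI allI impI)
  show "f \<in> borel_measurable (lebesgue_on S)"
    using assms by (intro continuous_imp_measurable_on_sets_lebesgue) auto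
  fix K assume K: "compact K \<and> K \<subseteq> S"
  have "integrable lborel (\<lambda>z. indicator K z *\<^sub>R (norm (f z))\<^sup>2)"
    using K by (intro borel_integrable_compact continuous_intros continuous_on_subset[OF f]) auto
  then show "set_integrable lebesgue K (\<lambda>z. (norm (f z))\<^sup>2)"
    unfolding set_integrable_def by (subst integrable_completion) auto
qed

text \<open>Both divergence conditions hold termwise: the first component does not depend on x1 and
  the third not on x3. The bound \<open>B\<close> is the speed limit that
  \<open>transport_weak\<close> needs to control supports.\<close>

lemma weak_solution_shear_flow:
  assumes u1: "continuous_on UNIV u1" "fun_on \<Omega> u1" "\<And>y. \<bar>u1 y\<bar> \<le> B"
    and u3: "continuous_on UNIV u3" "fun_on \<Omega> u3"
  shows "weak_solution \<Omega> (shear_flow u1 u3) (\<lambda>x. shear_flow u1 u3 x 0)"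
  unfolding weak_solution_def
proof (intro conjI allI impI)
  let ?v = "\<lambda>x :: real ^ 3. u1 (x $ 2)" and ?w = "\<lambda>x :: real ^ 3. u3 (x $ 1)"
  let ?w3 = "\<lambda>z :: (real ^ 3) \<times> real. u3 (fst z $ 1 - snd z * u1 (fst z $ 2))"
  have contv: "continuous_on UNIV ?v" and contw: "continuous_on UNIV ?w"
    by (intro continuous_on_compose2[OF u1(1)] continuous_on_compose2[OF u3(1)] continuous_intros; simp)+
  have contv': "continuous_on spacetime (\<lambda>z. ?v (fst z))" and contw3: "continuous_on spacetime ?w3"
    by (intro continuous_on_compose2[OF u1(1)] continuous_on_compose2[OF u3(1)] continuous_intros; simp)+
  note per = fun_on_component[OF u1(2), of 2] fun_on_component[OF u3(2), of 1]
  have closed_spacetime: "closed spacetime"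
    by (simp add: spacetime_def closed_Times)
  show "fun_on \<Omega> (\<lambda>x. shear_flow u1 u3 x 0)"
    by (rule fun_on_shear_flow[OF u1(2) u3(2)])
  show "fun_on \<Omega> (\<lambda>x. shear_flow u1 u3 x t)" for t
    by (rule fun_on_shear_flow[OF u1(2) u3(2)])
  show "L2_loc UNIV (\<lambda>x. shear_flow u1 u3 x 0)"
    by (intro L2_loc_continuous continuous_on_shear_flow u1 u3 continuous_intros)
  show "L2_loc spacetime (\<lambda>(x, t). shear_flow u1 u3 x t)"
    unfolding case_prod_unfold
    by (intro L2_loc_continuous continuous_on_shear_flow u1 u3 continuous_intros closed_spacetime)
  show "div_free_space \<Omega> (\<lambda>x. shear_flow u1 u3 x 0)"
    unfolding div_free_space_def
  proof (intro allI impI)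
    fix \<psi> assume \<psi>: "test_fun_space \<Omega> \<psi>"
    let ?d = "\<lambda>i. partial_deriv UNIV (axis i 1) \<psi>"
    have 1: "set_integrable lborel (cell \<Omega>) (\<lambda>x. ?v x * ?d 1 x)"
      "(LINT x:cell \<Omega>|lborel. ?v x * ?d 1 x) = 0"
      by (rule space_integral_deriv[OF \<psi> contv]; simp add: axis_def)+
    have 3: "set_integrable lborel (cell \<Omega>) (\<lambda>x. ?w x * ?d 3 x)"
      "(LINT x:cell \<Omega>|lborel. ?w x * ?d 3 x) = 0"
      by (rule space_integral_deriv[OF \<psi> contw]; simp add: axis_def)+
    show "(LINT x:cell \<Omega>|lebesgue. \<Sum>i\<in>UNIV. shear_flow u1 u3 x 0 $ i * ?d i x) = 0"
      using set_integral_lebesgue_lborel[OF set_integral_add(1)[OF 1(1) 3(1)]]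
        set_integral_add(2)[OF 1(1) 3(1)] 1(2) 3(2)
      by (simp add: sum_3)
  qed
  show "div_free \<Omega> (shear_flow u1 u3)"
    unfolding div_free_def
  proof (intro allI impI)
    fix \<psi> assume \<psi>: "test_fun \<Omega> \<psi>"
    let ?Q = "cell \<Omega> \<times> {0::real..}"
    have 1: "set_integrable lborel ?Q (\<lambda>z. ?v (fst z) * dx 1 \<psi> z)"
      "(LINT z:?Q|lborel. ?v (fst z) * dx 1 \<psi> z) = 0"
      by (rule spacetime_integral_deriv[OF \<psi> contv']; simp add: axis_def)+
    have 3: "set_integrable lborel ?Q (\<lambda>z. ?w3 z * dx 3 \<psi> z)"
      "(LINT z:?Q|lborel. ?w3 z * dx 3 \<psi> z) = 0"
      by (rule spacetime_integral_deriv[OF \<psi> contw3]; simp add: axis_def)+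
    show "set_lebesgue_integral lebesgue ?Q
      (\<lambda>(x, t). \<Sum>i\<in>UNIV. shear_flow u1 u3 x t $ i * dx i \<psi> (x, t)) = 0"
      using set_integral_lebesgue_lborel[OF set_integral_add(1)[OF 1(1) 3(1)]]
        set_integral_add(2)[OF 1(1) 3(1)] 1(2) 3(2)
      by (simp add: sum_3 case_prod_unfold)
  qed
  fix \<phi> :: "(real ^ 3) \<times> real \<Rightarrow> real ^ 3"
  assume "(\<forall>i. test_fun \<Omega> (\<lambda>z. \<phi> z $ i)) \<and>
    (\<forall>z\<in>spacetime. (\<Sum>i\<in>UNIV. dx i (\<lambda>z. \<phi> z $ i) z) = 0)"
  then have \<phi>: "test_fun \<Omega> (\<lambda>z. \<phi> z $ i)" for i
    by blast
  let ?Q = "cell \<Omega> \<times> {0::real..}"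
  \<comment> \<open>\<open>F1\<close> and \<open>F3\<close> collect the time derivative of a
    component of the test field and its derivative along e1; \<open>C1\<close> and \<open>C3\<close>
    are the remaining derivatives along e3. Everything else contains the vanishing second
    component.\<close>
  define F1 where "F1 z = ?v (fst z) * (dt (\<lambda>z. \<phi> z $ 1) z + ?v (fst z) * dx 1 (\<lambda>z. \<phi> z $ 1) z)" for z
  define F3 where "F3 z = ?w3 z * (dt (\<lambda>z. \<phi> z $ 3) z + ?v (fst z) * dx 1 (\<lambda>z. \<phi> z $ 3) z)" for z
  define C1 where "C1 z = (?v (fst z) * ?w3 z) * dx 3 (\<lambda>z. \<phi> z $ 1) z" for z
  define C3 where "C3 z = (?w3 z * ?w3 z) * dx 3 (\<lambda>z. \<phi> z $ 3) z" for z
  \<comment> \<open>Here the transported profile is u1(x2) itself; it does not depend on x1, so the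
    shift along e1 leaves it unchanged.\<close>
  have F1: "set_integrable lborel ?Q F1"
    "(LINT z:?Q|lborel. F1 z) = - (LINT x:cell \<Omega>|lborel. ?v x * \<phi> (x, 0) $ 1)"
    using transport_weak[OF \<phi> contv per(1) contv per(1) u1(3), where i = 1]
    unfolding F1_def by (simp_all add: axis_def)
  \<comment> \<open>Here the profile is u3(x1), which the shift turns into the third component of
    the flow.\<close>
  have F3: "set_integrable lborel ?Q F3"
    "(LINT z:?Q|lborel. F3 z) = - (LINT x:cell \<Omega>|lborel. ?w x * \<phi> (x, 0) $ 3)"
    using transport_weak[OF \<phi> contw per(2) contv per(1) u1(3), where i = 1]
    unfolding F3_def by (simp_all add: axis_def)
  have C1: "set_integrable lborel ?Q C1" "(LINT z:?Q|lborel. C1 z) = 0"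
    unfolding C1_def
    by (rule spacetime_integral_deriv[OF \<phi> continuous_on_mult[OF contv' contw3]]; simp add: axis_def)+
  have C3: "set_integrable lborel ?Q C3" "(LINT z:?Q|lborel. C3 z) = 0"
    unfolding C3_def
    by (rule spacetime_integral_deriv[OF \<phi> continuous_on_mult[OF contw3 contw3]]; simp add: axis_def)+
  note int = set_integral_add[OF F1(1) F3(1)]
  note int' = set_integral_add[OF int(1) C1(1)]
  note int'' = set_integral_add[OF int'(1) C3(1)]
  have ini1: "set_integrable lborel (cell \<Omega>) (\<lambda>x. ?v x * \<phi> (x, 0) $ 1)"
    by (rule set_integrable_initial[OF \<phi> contv])
  have ini3: "set_integrable lborel (cell \<Omega>) (\<lambda>x. ?w x * \<phi> (x, 0) $ 3)"
    by (rule set_integrable_initial[OF \<phi> contw])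
  note ini = set_integral_add[OF ini1 ini3]
  have "set_lebesgue_integral lebesgue ?Q
      (\<lambda>(x, t). (\<Sum>i\<in>UNIV. shear_flow u1 u3 x t $ i * dt (\<lambda>z. \<phi> z $ i) (x, t)) +
        (\<Sum>i\<in>UNIV. \<Sum>j\<in>UNIV. shear_flow u1 u3 x t $ i * shear_flow u1 u3 x t $ j *
          dx j (\<lambda>z. \<phi> z $ i) (x, t))) =
    set_lebesgue_integral lebesgue ?Q (\<lambda>z. F1 z + F3 z + C1 z + C3 z)"
    by (rule arg_cong[where f = "set_lebesgue_integral lebesgue ?Q"])
      (auto simp: fun_eq_iff sum_3 F1_def F3_def C1_def C3_def algebra_simps)
  also have "\<dots> = set_lebesgue_integral lborel ?Q (\<lambda>z. F1 z + F3 z + C1 z + C3 z)"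
    by (rule set_integral_lebesgue_lborel[OF int''(1)])
  also have "\<dots> = - (LINT x:cell \<Omega>|lborel. ?v x * \<phi> (x, 0) $ 1 + ?w x * \<phi> (x, 0) $ 3)"
    by (simp add: int'' int' int ini F1 F3 C1 C3)
  also have "\<dots> = - (LINT x:cell \<Omega>|lebesgue. ?v x * \<phi> (x, 0) $ 1 + ?w x * \<phi> (x, 0) $ 3)"
    by (simp add: set_integral_lebesgue_lborel[OF ini(1)])
  also have "\<dots> = - (LINT x:cell \<Omega>|lebesgue. shear_flow u1 u3 x 0 \<bullet> \<phi> (x, 0))"
    by (simp add: inner_vec_def sum_3)
  finally show "set_lebesgue_integral lebesgue ?Q
      (\<lambda>(x, t). (\<Sum>i\<in>UNIV. shear_flow u1 u3 x t $ i * dt (\<lambda>z. \<phi> z $ i) (x, t)) +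
        (\<Sum>i\<in>UNIV. \<Sum>j\<in>UNIV. shear_flow u1 u3 x t $ i * shear_flow u1 u3 x t $ j *
          dx j (\<lambda>z. \<phi> z $ i) (x, t))) =
    - (LINT x:cell \<Omega>|lebesgue. shear_flow u1 u3 x 0 \<bullet> \<phi> (x, 0))" .
qed

section \<open>Hoelder spaces\<close>

text \<open>At distances above 1 the denominator of the Hoelder quotient is at least 1, so
  boundedness alone gives \<open>2 * B\<close> there and only nearby points need a modulus.\<close>

lemma C0_holderI:
  fixes f :: "'a::euclidean_space \<Rightarrow> real"
  assumes per: "fun_on \<Omega> f" and B: "\<And>x. \<bar>f x\<bar> \<le> B" and "0 \<le> \<alpha>"
    and C: "\<And>x y. norm (x - y) \<le> 1 \<Longrightarrow> \<bar>f x - f y\<bar> \<le> C * norm (x - y) powr \<alpha>"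
  shows "f \<in> C0_holder \<Omega> \<alpha>"
  unfolding C0_holder_def
proof (intro CollectI conjI per)
  show "bounded (range f)"
    using B by (auto simp: bounded_iff)
  have "\<bar>f x - f y\<bar> / norm (x - y) powr \<alpha> \<le> max C (2 * B)" if "x \<noteq> y" for x y
  proof (cases "norm (x - y) \<le> 1")
    case True
    then have "\<bar>f x - f y\<bar> / norm (x - y) powr \<alpha> \<le> C"
      using C[OF True] that by (simp add: divide_le_eq)
    then show ?thesis
      by simp
  next
    case False
    then have 1: "1 \<le> norm (x - y) powr \<alpha>"
      using \<open>0 \<le> \<alpha>\<close> by (simp add: ge_one_powr_ge_zero)
    have "\<bar>f x - f y\<bar> / norm (x - y) powr \<alpha> \<le> \<bar>f x - f y\<bar> / 1"
      using 1 by (intro divide_left_mono) auto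
    also have "\<dots> \<le> 2 * B"
      using B[of x] B[of y] by auto
    finally show ?thesis
      by simp
  qed
  then show "bdd_above {\<bar>f x - f y\<bar> / norm (x - y) powr \<alpha> | x y. x \<noteq> y}"
    by (intro bdd_aboveI[of _ "max C (2 * B)"]) auto
qed

lemma C0_holderE:
  fixes f :: "'a::euclidean_space \<Rightarrow> real"
  assumes "f \<in> C0_holder \<Omega> \<alpha>"
  obtains B C where "0 \<le> B" "0 \<le> C" "\<And>x. \<bar>f x\<bar> \<le> B"
    "\<And>x y. \<bar>f x - f y\<bar> \<le> C * norm (x - y) powr \<alpha>"
proof -
  obtain B where B: "0 < B" "\<And>x. \<bar>f x\<bar> \<le> B"
    using assms by (auto simp: C0_holder_def bounded_pos)
  obtain C where C: "\<And>x y. x \<noteq> y \<Longrightarrow> \<bar>f x - f y\<bar> / norm (x - y) powr \<alpha> \<le> C"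
    using assms unfolding C0_holder_def bdd_above_def by blast
  \<comment> \<open>\<open>max 0 C\<close> is a nonnegative constant without having to exhibit two
    distinct points.\<close>
  have "\<bar>f x - f y\<bar> \<le> max 0 C * norm (x - y) powr \<alpha>" for x y
  proof (cases "x = y")
    case False
    then have "\<bar>f x - f y\<bar> / norm (x - y) powr \<alpha> \<le> max 0 C"
      using C[OF False] by simp
    with False show ?thesis
      by (simp add: divide_le_eq)
  qed simp
  with B show thesis
    by (intro that[of B "max 0 C"]) auto
qed

lemma C0_holder_fun_on: "f \<in> C0_holder \<Omega> \<alpha> \<Longrightarrow> fun_on \<Omega> f"
  by (simp add: C0_holder_def)

lemma C0_holder_const: "0 \<le> \<alpha> \<Longrightarrow> (\<lambda>x. c) \<in> C0_holder \<Omega> \<alpha>"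
  by (rule C0_holderI[of _ _ "\<bar>c\<bar>" _ 0]) (auto simp: fun_on_def)

lemma C0_holder_mult:
  fixes f g :: "'a::euclidean_space \<Rightarrow> real"
  assumes f: "f \<in> C0_holder \<Omega> \<alpha>" and g: "g \<in> C0_holder \<Omega> \<alpha>" and "0 \<le> \<alpha>"
  shows "(\<lambda>x. f x * g x) \<in> C0_holder \<Omega> \<alpha>"
proof -
  obtain A C where f': "0 \<le> A" "0 \<le> C" "\<And>x. \<bar>f x\<bar> \<le> A"
    "\<And>x y. \<bar>f x - f y\<bar> \<le> C * norm (x - y) powr \<alpha>"
    using C0_holderE[OF f] by blast
  obtain B D where g': "0 \<le> B" "0 \<le> D" "\<And>x. \<bar>g x\<bar> \<le> B"
    "\<And>x y. \<bar>g x - g y\<bar> \<le> D * norm (x - y) powr \<alpha>"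
    using C0_holderE[OF g] by blast
  show ?thesis
  proof (rule C0_holderI[of _ _ "A * B" _ "A * D + B * C"])
    show "fun_on \<Omega> (\<lambda>x. f x * g x)"
      using C0_holder_fun_on[OF f] C0_holder_fun_on[OF g] by (simp add: fun_on_def)
    show "\<bar>f x * g x\<bar> \<le> A * B" for x
      using f' g' by (auto simp: abs_mult intro!: mult_mono)
    fix x y
    have "\<bar>f x * g x - f y * g y\<bar> = \<bar>f x * (g x - g y) + g y * (f x - f y)\<bar>"
      by (simp add: algebra_simps)
    also have "\<dots> \<le> \<bar>f x\<bar> * \<bar>g x - g y\<bar> + \<bar>g y\<bar> * \<bar>f x - f y\<bar>"
      by (simp add: abs_mult order_trans[OF abs_triangle_ineq])
    also have "\<dots> \<le> A * (D * norm (x - y) powr \<alpha>) + B * (C * norm (x - y) powr \<alpha>)"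
      using f' g' by (intro add_mono mult_mono) auto
    finally show "\<bar>f x * g x - f y * g y\<bar> \<le> (A * D + B * C) * norm (x - y) powr \<alpha>"
      by (simp add: algebra_simps)
  qed fact
qed

lemma C0_holder_diff:
  fixes f g :: "'a::euclidean_space \<Rightarrow> real"
  assumes f: "f \<in> C0_holder \<Omega> \<alpha>" and g: "g \<in> C0_holder \<Omega> \<alpha>" and "0 \<le> \<alpha>"
  shows "(\<lambda>x. f x - g x) \<in> C0_holder \<Omega> \<alpha>"
proof -
  obtain A C where f': "0 \<le> A" "0 \<le> C" "\<And>x. \<bar>f x\<bar> \<le> A"
    "\<And>x y. \<bar>f x - f y\<bar> \<le> C * norm (x - y) powr \<alpha>"
    using C0_holderE[OF f] by blast
  obtain B D where g': "0 \<le> B" "0 \<le> D" "\<And>x. \<bar>g x\<bar> \<le> B"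
    "\<And>x y. \<bar>g x - g y\<bar> \<le> D * norm (x - y) powr \<alpha>"
    using C0_holderE[OF g] by blast
  show ?thesis
  proof (rule C0_holderI[of _ _ "A + B" _ "C + D"])
    show "fun_on \<Omega> (\<lambda>x. f x - g x)"
      using C0_holder_fun_on[OF f] C0_holder_fun_on[OF g] by (simp add: fun_on_def)
    show "\<bar>f x - g x\<bar> \<le> A + B" for x
      using f'(3)[of x] g'(3)[of x] by linarith
    show "\<bar>(f x - g x) - (f y - g y)\<bar> \<le> (C + D) * norm (x - y) powr \<alpha>" for x y
      using f'(4)[of x y] g'(4)[of x y] by (simp add: distrib_right)
  qed fact
qed

lemma C0_holder_mono:
  fixes f :: "'a::euclidean_space \<Rightarrow> real"
  assumes f: "f \<in> C0_holder \<Omega> \<alpha>" and "0 \<le> \<beta>" "\<beta> \<le> \<alpha>"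
  shows "f \<in> C0_holder \<Omega> \<beta>"
proof -
  obtain B C where f': "0 \<le> B" "0 \<le> C" "\<And>x. \<bar>f x\<bar> \<le> B"
    "\<And>x y. \<bar>f x - f y\<bar> \<le> C * norm (x - y) powr \<alpha>"
    using C0_holderE[OF f] by blast
  show ?thesis
  proof (rule C0_holderI[of _ _ B _ C])
    show "\<bar>f x - f y\<bar> \<le> C * norm (x - y) powr \<beta>" if "norm (x - y) \<le> 1" for x y
    proof -
      have "C * norm (x - y) powr \<alpha> \<le> C * norm (x - y) powr \<beta>"
        using that assms f'(2) by (intro mult_left_mono powr_mono') auto
      then show ?thesis
        using f'(4)[of x y] by linarith
    qed
  qed (use C0_holder_fun_on[OF f] f' assms in auto)
qed

lemma C0_holder_continuous:
  fixes f :: "'a::euclidean_space \<Rightarrow> real"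
  assumes f: "f \<in> C0_holder \<Omega> \<alpha>" and "0 < \<alpha>"
  shows "continuous_on UNIV f"
proof -
  obtain B C where "0 \<le> B" "0 \<le> C" "\<And>x. \<bar>f x\<bar> \<le> B"
    and C: "\<And>x y. \<bar>f x - f y\<bar> \<le> C * norm (x - y) powr \<alpha>"
    using C0_holderE[OF f] by blast
  have "isCont f a" for a
    unfolding isCont_def
  proof (rule Lim_transform_bound[where g = "\<lambda>x. C * norm (x - a) powr \<alpha>", THEN Lim_null[THEN iffD2]])
    show "\<forall>\<^sub>F x in at a. norm (f x - f a) \<le> norm (C * norm (x - a) powr \<alpha>)"
      using C by (intro always_eventually allI) (simp add: order_trans[OF C])
    have "((\<lambda>x. norm (x - a)) \<longlongrightarrow> 0) (at a)"
      by (intro tendsto_norm_zero) (simp add: LIM_zero)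
    then have "((\<lambda>x. norm (x - a) powr \<alpha>) \<longlongrightarrow> 0) (at a)"
      using tendsto_powr'[of _ 0 _ "\<lambda>_. \<alpha>" \<alpha>] \<open>0 < \<alpha>\<close> by fastforce
    then show "((\<lambda>x. C * norm (x - a) powr \<alpha>) \<longlongrightarrow> 0) (at a)"
      by (rule tendsto_mult_right_zero)
  qed
  then show ?thesis
    by (simp add: continuous_on_eq_continuous_at)
qed

text \<open>Exponents multiply under composition. The inner map will be x1 - t u1(x2): it is not
  periodic, so periodicity is asked of the composite, and it is unbounded, so its modulus is asked
  only at distances up to 1.\<close>

lemma C0_holder_compose:
  fixes g :: "'a::euclidean_space \<Rightarrow> real"
  assumes w: "w \<in> C0_holder \<Omega> \<alpha>" and "0 \<le> \<alpha>" "0 \<le> \<gamma>" "0 \<le> L"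
    and per: "fun_on \<Omega> (\<lambda>x. w (g x))"
    and g: "\<And>x y. norm (x - y) \<le> 1 \<Longrightarrow> \<bar>g x - g y\<bar> \<le> L * norm (x - y) powr \<gamma>"
  shows "(\<lambda>x. w (g x)) \<in> C0_holder \<Omega> (\<gamma> * \<alpha>)"
proof -
  obtain B C where w': "0 \<le> B" "0 \<le> C" "\<And>x. \<bar>w x\<bar> \<le> B"
    "\<And>x y. \<bar>w x - w y\<bar> \<le> C * norm (x - y) powr \<alpha>"
    using C0_holderE[OF w] by blast
  show ?thesis
  proof (rule C0_holderI[OF per, of B _ "C * L powr \<alpha>"])
    fix x y :: 'a
    assume 1: "norm (x - y) \<le> 1"
    have "\<bar>w (g x) - w (g y)\<bar> \<le> C * \<bar>g x - g y\<bar> powr \<alpha>"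
      using w'(4)[of "g x" "g y"] by simp
    also have "\<dots> \<le> C * (L * norm (x - y) powr \<gamma>) powr \<alpha>"
      using w'(2) g[OF 1] \<open>0 \<le> \<alpha>\<close> by (intro mult_left_mono powr_mono2) auto
    also have "\<dots> = C * L powr \<alpha> * norm (x - y) powr (\<gamma> * \<alpha>)"
      using \<open>0 \<le> L\<close> by (simp add: powr_mult powr_powr)
    finally show "\<bar>w (g x) - w (g y)\<bar> \<le> C * L powr \<alpha> * norm (x - y) powr (\<gamma> * \<alpha>)" .
  qed (use w' assms in auto)
qed

lemma C0_holder_component:
  fixes w :: "real \<Rightarrow> real"
  assumes w: "w \<in> C0_holder \<Omega> \<alpha>" and "0 \<le> \<alpha>"
  shows "(\<lambda>x :: real ^ 3. w (x $ i)) \<in> C0_holder \<Omega> \<alpha>"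
proof -
  have "(\<lambda>x :: real ^ 3. w (x $ i)) \<in> C0_holder \<Omega> (1 * \<alpha>)"
  proof (rule C0_holder_compose[OF w \<open>0 \<le> \<alpha>\<close>, of 1 1])
    show "\<bar>x $ i - y $ i\<bar> \<le> 1 * norm (x - y) powr 1" for x y :: "real ^ 3"
      using component_le_norm_cart[of "x - y" i] by simp
  qed (use fun_on_component[OF C0_holder_fun_on[OF w]] in auto)
  then show ?thesis
    by simp
qed

lemma C0_holder_shear_flow:
  assumes u1: "u1 \<in> C0_holder \<Omega> \<alpha>" and u3: "u3 \<in> C0_holder \<Omega> \<alpha>" and \<alpha>: "0 < \<alpha>" "\<alpha> \<le> 1"
  shows "(\<lambda>x. shear_flow u1 u3 x t) \<in> componentwise (C0_holder \<Omega> (\<alpha>\<^sup>2))"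
proof -
  have sq: "\<alpha>\<^sup>2 \<le> \<alpha>"
    using \<alpha> by (simp add: power2_eq_square mult_left_le)
  have 1: "(\<lambda>x :: real ^ 3. u1 (x $ 2)) \<in> C0_holder \<Omega> (\<alpha>\<^sup>2)"
    using C0_holder_mono[OF C0_holder_component[OF u1] _ sq] \<alpha> by simp
  obtain B C where "0 \<le> B" and C: "0 \<le> C" and "\<And>x. \<bar>u1 x\<bar> \<le> B"
    and C': "\<And>x y. \<bar>u1 x - u1 y\<bar> \<le> C * norm (x - y) powr \<alpha>"
    using C0_holderE[OF u1] by blast
  have "(\<lambda>x :: real ^ 3. u3 (x $ 1 - t * u1 (x $ 2))) \<in> C0_holder \<Omega> (\<alpha> * \<alpha>)"
  proof (rule C0_holder_compose[OF u3, of _ "1 + \<bar>t\<bar> * C"])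
    fix x y :: "real ^ 3"
    assume n: "norm (x - y) \<le> 1"
    \<comment> \<open>At distance at most 1 the Lipschitz term x1 also obeys the weaker modulus of
      exponent \<open>\<alpha>\<close>, so the whole inner map does.\<close>
    have "norm (x - y) = norm (x - y) powr 1"
      by simp
    also have "\<dots> \<le> norm (x - y) powr \<alpha>"
      using n \<alpha> by (intro powr_mono') auto
    finally have "\<bar>x $ 1 - y $ 1\<bar> \<le> norm (x - y) powr \<alpha>"
      using component_le_norm_cart[of "x - y" 1] by simp
    moreover have "\<bar>u1 (x $ 2) - u1 (y $ 2)\<bar> \<le> C * norm (x - y) powr \<alpha>"
    proof -
      have "C * \<bar>x $ 2 - y $ 2\<bar> powr \<alpha> \<le> C * norm (x - y) powr \<alpha>"
        using component_le_norm_cart[of "x - y" 2] \<alpha> C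
        by (intro mult_left_mono powr_mono2) auto
      then show ?thesis
        using C'[of "x $ 2" "y $ 2"] by simp
    qed
    then have "\<bar>t * u1 (x $ 2) - t * u1 (y $ 2)\<bar> \<le> \<bar>t\<bar> * (C * norm (x - y) powr \<alpha>)"
      by (simp add: abs_mult mult_left_mono flip: right_diff_distrib)
    ultimately show "\<bar>(x $ 1 - t * u1 (x $ 2)) - (y $ 1 - t * u1 (y $ 2))\<bar> \<le>
        (1 + \<bar>t\<bar> * C) * norm (x - y) powr \<alpha>"
      by (simp add: algebra_simps)
  qed (use \<alpha> C fun_on_shear_component C0_holder_fun_on[OF u1] C0_holder_fun_on[OF u3] in auto)
  then have 3: "(\<lambda>x :: real ^ 3. u3 (x $ 1 - t * u1 (x $ 2))) \<in> C0_holder \<Omega> (\<alpha>\<^sup>2)"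
    by (simp add: power2_eq_square)
  show ?thesis
    using 1 3 C0_holder_const[of "\<alpha>\<^sup>2"] by (simp add: componentwise_def forall_3)
qed

section \<open>Composition and shear flows in the C^1 Hoelder class\<close>

lemma C1_holder_real_derivative:
  fixes w :: "real \<Rightarrow> real"
  assumes "w \<in> C1_holder \<Omega> \<alpha>"
  shows "(w has_real_derivative partial_deriv UNIV 1 w y) (at y)"
proof -
  have "(w has_derivative frechet_derivative w (at y)) (at y)"
    using assms by (auto simp: C1_holder_def differentiable_on_def simp flip: frechet_derivative_works)
  moreover from this have "frechet_derivative w (at y) h = h * partial_deriv UNIV 1 w y" for h
    using linear_scale[OF has_derivative_linear, of w _ _ h 1] by (simp add: partial_deriv_def)
  then have "frechet_derivative w (at y) = (*) (partial_deriv UNIV 1 w y)"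
    by (simp add: fun_eq_iff mult.commute)
  ultimately show ?thesis
    by (simp add: has_field_derivative_def)
qed

text \<open>The partial derivatives are w'(g) times those of \<open>g\<close>; as \<open>g\<close>
  is Lipschitz, w'(g) keeps the exponent \<open>\<alpha>\<close>, and Hoelder functions form an
  algebra. \<open>per\<close> ranges over all \<open>v\<close> since it is applied both to
  \<open>w\<close> and to its derivative.\<close>

lemma C1_holder_compose:
  fixes g :: "'a::euclidean_space \<Rightarrow> real"
  assumes w: "w \<in> C1_holder \<Omega> \<alpha>" and "0 < \<alpha>" and "0 \<le> L"
    and deriv: "\<And>x. (g has_derivative g' x) (at x)"
    and lip: "\<And>x y. \<bar>g x - g y\<bar> \<le> L * norm (x - y)"
    and holder: "\<And>b. b \<in> Basis \<Longrightarrow> (\<lambda>x. g' x b) \<in> C0_holder \<Omega> \<alpha>"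
    and per: "\<And>v :: real \<Rightarrow> real. fun_on \<Omega> v \<Longrightarrow> fun_on \<Omega> (\<lambda>x. v (g x))"
  shows "(\<lambda>x. w (g x)) \<in> C1_holder \<Omega> \<alpha>"
proof -
  let ?w' = "partial_deriv UNIV 1 w"
  have w': "?w' \<in> C0_holder \<Omega> \<alpha>"
    using w by (simp add: C1_holder_def)
  have D: "((\<lambda>x. w (g x)) has_derivative (\<lambda>h. ?w' (g x) * g' x h)) (at x)" for x
    using has_derivative_compose[OF deriv] C1_holder_real_derivative[OF w, of "g x"]
    by (auto simp: has_field_derivative_def)
  have partial: "partial_deriv UNIV b (\<lambda>x. w (g x)) = (\<lambda>x. ?w' (g x) * g' x b)" for b
    using frechet_derivative_at[OF D, symmetric] by (simp add: partial_deriv_def fun_eq_iff)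
  have "(\<lambda>x. ?w' (g x)) \<in> C0_holder \<Omega> (1 * \<alpha>)"
    by (rule C0_holder_compose[OF w' _ _ \<open>0 \<le> L\<close>])
      (use lip per C0_holder_fun_on[OF w'] \<open>0 < \<alpha>\<close> in auto)
  then have H: "partial_deriv UNIV b (\<lambda>x. w (g x)) \<in> C0_holder \<Omega> \<alpha>" if "b \<in> Basis" for b
    unfolding partial using that \<open>0 < \<alpha>\<close> by (intro C0_holder_mult holder) auto
  show ?thesis
    unfolding C1_holder_def
  proof (intro CollectI conjI ballI H)
    show "fun_on \<Omega> (\<lambda>x. w (g x))"
      using w by (intro per) (simp add: C1_holder_def)
    have "bounded (range w)"
      using w by (simp add: C1_holder_def)
    then show "bounded (range (\<lambda>x. w (g x)))"
      by (rule bounded_subset) auto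
    show "Ck_on 1 UNIV (\<lambda>x. w (g x))"
      using D H C0_holder_continuous[OF H \<open>0 < \<alpha>\<close>]
      by (auto simp: differentiable_on_def differentiable_def One_nat_def)
  qed
qed

lemma C1_holder_const:
  fixes c :: real
  assumes "0 \<le> \<alpha>"
  shows "(\<lambda>x :: 'a::euclidean_space. c) \<in> C1_holder \<Omega> \<alpha>"
proof -
  have "partial_deriv UNIV b (\<lambda>x :: 'a. c) = (\<lambda>x. 0)" for b
    by (simp add: partial_deriv_def fun_eq_iff)
  then show ?thesis
    by (simp add: C1_holder_def fun_on_def C0_holder_const[OF assms])
qed

lemma C1_holder_shear_flow:
  assumes u1: "u1 \<in> C1_holder \<Omega> \<alpha>" and u3: "u3 \<in> C1_holder \<Omega> \<alpha>" and \<alpha>: "0 < \<alpha>"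
  shows "(\<lambda>x. shear_flow u1 u3 x t) \<in> componentwise (C1_holder \<Omega> \<alpha>)"
proof -
  let ?u1' = "partial_deriv UNIV 1 u1"
  have u1': "?u1' \<in> C0_holder \<Omega> \<alpha>" and per1: "fun_on \<Omega> u1"
    using u1 by (auto simp: C1_holder_def)
  obtain B C where B: "0 \<le> B" and "0 \<le> C" and B': "\<And>x. \<bar>?u1' x\<bar> \<le> B"
    and "\<And>x y. \<bar>?u1' x - ?u1' y\<bar> \<le> C * norm (x - y) powr \<alpha>"
    using C0_holderE[OF u1'] by blast
  \<comment> \<open>The bounded derivative makes the displacement t u1(x2) Lipschitz, and this is
    what prevents a loss of exponent.\<close>
  have lip: "\<bar>u1 a - u1 b\<bar> \<le> B * \<bar>a - b\<bar>" for a b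
    using field_differentiable_bound[of UNIV u1 ?u1' B a b] C1_holder_real_derivative[OF u1] B B' by simp
  have 1: "(\<lambda>x :: real ^ 3. u1 (x $ 2)) \<in> C1_holder \<Omega> \<alpha>"
  proof (rule C1_holder_compose[OF u1 \<alpha>, of 1 _ "\<lambda>x h. h $ 2"])
    show "((\<lambda>x :: real ^ 3. x $ 2) has_derivative (\<lambda>h. h $ 2)) (at x)" for x
      by (rule bounded_linear_imp_has_derivative[OF bounded_linear_vec_nth])
    show "\<bar>x $ 2 - y $ 2\<bar> \<le> 1 * norm (x - y)" for x y :: "real ^ 3"
      using component_le_norm_cart[of "x - y" 2] by simp
    show "(\<lambda>x :: real ^ 3. b $ 2) \<in> C0_holder \<Omega> \<alpha>" for b :: "real ^ 3"
      using \<alpha> by (intro C0_holder_const) simp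
  qed (use fun_on_component in auto)
  have 3: "(\<lambda>x :: real ^ 3. u3 (x $ 1 - t * u1 (x $ 2))) \<in> C1_holder \<Omega> \<alpha>"
  proof (rule C1_holder_compose[OF u3 \<alpha>, of "1 + \<bar>t\<bar> * B" _ "\<lambda>x h. h $ 1 - t * h $ 2 * ?u1' (x $ 2)"])
    show "((\<lambda>x :: real ^ 3. x $ 1 - t * u1 (x $ 2)) has_derivative
        (\<lambda>h. h $ 1 - t * h $ 2 * ?u1' (x $ 2))) (at x)" for x
    proof -
      note nth = bounded_linear_imp_has_derivative[OF bounded_linear_vec_nth]
      have "((\<lambda>x :: real ^ 3. u1 (x $ 2)) has_derivative (\<lambda>h. ?u1' (x $ 2) * h $ 2)) (at x)"
        using has_derivative_compose[OF nth] C1_holder_real_derivative[OF u1, of "x $ 2"]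
        by (simp add: has_field_derivative_def)
      from has_derivative_diff[OF nth[of 1] has_derivative_mult_right[OF this, of t]]
      show ?thesis
        by (simp add: mult_ac)
    qed
    fix x y :: "real ^ 3"
    have "\<bar>x $ 1 - y $ 1\<bar> \<le> norm (x - y)" and 2: "\<bar>x $ 2 - y $ 2\<bar> \<le> norm (x - y)"
      using component_le_norm_cart[of "x - y"] by auto
    moreover have "\<bar>u1 (x $ 2) - u1 (y $ 2)\<bar> \<le> B * norm (x - y)"
      using lip[of "x $ 2" "y $ 2"] mult_left_mono[OF 2 B] by linarith
    then have "\<bar>t * u1 (x $ 2) - t * u1 (y $ 2)\<bar> \<le> \<bar>t\<bar> * (B * norm (x - y))"
      by (simp add: abs_mult mult_left_mono flip: right_diff_distrib)
    ultimately show "\<bar>(x $ 1 - t * u1 (x $ 2)) - (y $ 1 - t * u1 (y $ 2))\<bar> \<le>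
        (1 + \<bar>t\<bar> * B) * norm (x - y)"
      by (simp add: algebra_simps)
  next
    fix b :: "real ^ 3"
    show "(\<lambda>x :: real ^ 3. b $ 1 - t * b $ 2 * ?u1' (x $ 2)) \<in> C0_holder \<Omega> \<alpha>"
      using \<alpha> by (intro C0_holder_diff C0_holder_mult C0_holder_const C0_holder_component[OF u1']) auto
  qed (use B fun_on_shear_component[OF _ per1] in auto)
  show ?thesis
    using 1 3 C1_holder_const[of \<alpha> 0] \<alpha> by (simp add: componentwise_def forall_3)
qed

section \<open>The square root cusp\<close>

text \<open>The absolute value makes the root real and halves the period of sin(pi s) to 1, so one
  profile serves both domains.\<close>

definition cusp :: "real \<Rightarrow> real" where
  "cusp s = sqrt \<bar>sin (pi * s)\<bar>"

lemma cusp_properties: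
  shows cusp_fun_on: "fun_on \<Omega> cusp"
    and cusp_bounded: "\<bar>cusp s\<bar> \<le> 1"
    and cusp_holder: "\<bar>cusp a - cusp b\<bar> \<le> sqrt pi * norm (a - b) powr (1 / 2)"
proof -
  have "cusp (x + k) = cusp x" if "k \<in> \<int>" for x k
  proof -
    have s: "sin (pi * k) = 0"
      using that by (auto elim!: Ints_cases)
    then have "\<bar>cos (pi * k)\<bar> = 1"
      using sin_cos_squared_add[of "pi * k"] by (auto simp: power2_eq_1_iff)
    \<comment> \<open>A shift by an integer can only change the sign of the sine, which the absolute
      value absorbs.\<close>
    with s show ?thesis
      by (simp add: cusp_def distrib_left sin_add abs_mult)
  qed
  then show "fun_on \<Omega> cusp"
    by (auto simp: fun_on_def)
  show "\<bar>cusp s\<bar> \<le> 1"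
    by (simp add: cusp_def)
  \<comment> \<open>The root is subadditive, hence 1/2-Hoelder with constant 1; the factor
    \<open>sqrt pi\<close> comes from the Lipschitz constant of sin(pi s).\<close>
  have sqrt_diff: "\<bar>sqrt x - sqrt y\<bar> \<le> sqrt \<bar>x - y\<bar>" if "0 \<le> x" "0 \<le> y" for x y :: real
  proof -
    have "sqrt u - sqrt v \<le> sqrt (u - v)" if "0 \<le> v" "v \<le> u" for u v :: real
      using sqrt_add_le_add_sqrt[of v "u - v"] that by simp
    from this[of x y] this[of y x] that show ?thesis
      by (cases "x \<le> y") (auto simp: abs_if)
  qed
  have "\<bar>sin (pi * a) - sin (pi * b)\<bar> \<le> 1 * \<bar>pi * a - pi * b\<bar>"
    using field_differentiable_bound[of UNIV sin cos 1 "pi * a" "pi * b"] by (simp add: DERIV_sin)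
  then have "\<bar>\<bar>sin (pi * a)\<bar> - \<bar>sin (pi * b)\<bar>\<bar> \<le> pi * \<bar>a - b\<bar>"
    using abs_triangle_ineq3[of "sin (pi * a)" "sin (pi * b)"]
    by (simp add: abs_mult flip: right_diff_distrib)
  then have "sqrt \<bar>\<bar>sin (pi * a)\<bar> - \<bar>sin (pi * b)\<bar>\<bar> \<le> sqrt (pi * \<bar>a - b\<bar>)"
    by simp
  then show "\<bar>cusp a - cusp b\<bar> \<le> sqrt pi * norm (a - b) powr (1 / 2)"
    using sqrt_diff[of "\<bar>sin (pi * a)\<bar>" "\<bar>sin (pi * b)\<bar>"]
    by (simp add: cusp_def real_sqrt_mult powr_half_sqrt)
qed

lemma cusp_in_C0_holder: "cusp \<in> C0_holder \<Omega> (1 / 2)"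
  by (rule C0_holderI[OF cusp_fun_on cusp_bounded _ cusp_holder]) simp

text \<open>Near 0 \<open>cusp h\<close> is asymptotic to sqrt(pi h), so the numerator is asymptotic
  to a positive constant times h^(1/4), which dominates h^\<beta>.\<close>

lemma cusp_cusp_at_top:
  assumes "t \<noteq> 0" "1 / 4 < \<beta>"
  shows "filterlim (\<lambda>h. cusp (t * cusp h) / h powr \<beta>) at_top (at_right 0)"
proof -
  \<comment> \<open>\<open>cusp\<close> is even, so only the absolute value of \<open>t\<close>
    matters and the asymptotic expansion can be done for a positive parameter.\<close>
  have "filterlim (\<lambda>h. sqrt \<bar>sin (pi * (s * sqrt \<bar>sin (pi * h)\<bar>))\<bar> / h powr \<beta>) at_top (at_right 0)"
    if "0 < s" for s :: real
    using that assms(2) by real_asymp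
  from this[of "\<bar>t\<bar>"] show ?thesis
    using assms(1) by (cases "0 \<le> t") (simp_all add: cusp_def)
qed

lemma shear_flow_cusp_not_holder:
  assumes "t \<noteq> 0" "1 / 4 < \<beta>"
  shows "(\<lambda>x. shear_flow cusp cusp x t) \<notin> componentwise (C0_holder \<Omega> \<beta>)"
proof
  assume "(\<lambda>x. shear_flow cusp cusp x t) \<in> componentwise (C0_holder \<Omega> \<beta>)"
  then have "(\<lambda>x. shear_flow cusp cusp x t $ 3) \<in> C0_holder \<Omega> \<beta>"
    unfolding componentwise_def by blast
  from C0_holderE[OF this] obtain B C where "0 \<le> B" "0 \<le> C" "\<And>x :: real ^ 3. \<bar>shear_flow cusp cusp x t $ 3\<bar> \<le> B"
    and C: "\<And>x y :: real ^ 3.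
      \<bar>shear_flow cusp cusp x t $ 3 - shear_flow cusp cusp y t $ 3\<bar> \<le> C * norm (x - y) powr \<beta>"
    by blast
  have "cusp (- t * cusp h) / h powr \<beta> \<le> C" if "0 < h" for h
  proof -
    \<comment> \<open>The points 0 and \<open>h\<close> times e2 share x1 = 0, so the third
      component becomes \<open>cusp (- t * cusp h)\<close> at one and \<open>cusp 0 = 0\<close> at
      the other.\<close>
    have "norm (h *\<^sub>R axis 2 1 :: real ^ 3) = h" "(h *\<^sub>R axis 2 1 :: real ^ 3) $ 1 = 0"
      "(h *\<^sub>R axis 2 1 :: real ^ 3) $ 2 = h"
      using that by (simp, simp_all add: axis_def)
    then show ?thesis
      using C[of "h *\<^sub>R axis 2 1" 0] that by (simp add: cusp_def divide_le_eq)
  qed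
  then have "\<forall>\<^sub>F h in at_right 0. cusp (- t * cusp h) / h powr \<beta> \<le> C"
    by (auto simp: eventually_at_filter)
  moreover have "\<forall>\<^sub>F h in at_right 0. C < cusp (- t * cusp h) / h powr \<beta>"
    using cusp_cusp_at_top[of "- t" \<beta>] assms by (simp add: filterlim_at_top_dense)
  ultimately have "\<forall>\<^sub>F h in at_right (0::real). False"
    by eventually_elim simp
  then show False
    by simp
qed

theorem theorem5:
  fixes \<Omega> :: domain
  shows
    "(\<forall>\<alpha> u1 u3. 0 < \<alpha> \<and> \<alpha> \<le> 1 \<and> u1 \<in> C1_holder \<Omega> \<alpha> \<and> u3 \<in> C1_holder \<Omega> \<alpha> \<longrightarrow>
        (\<forall>t. (\<lambda>x. shear_flow u1 u3 x t) \<in> componentwise (C1_holder \<Omega> \<alpha>))) \<and>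
     (\<forall>\<alpha> u1 u3. 0 < \<alpha> \<and> \<alpha> < 1 \<and> u1 \<in> C0_holder \<Omega> \<alpha> \<and> u3 \<in> C0_holder \<Omega> \<alpha> \<longrightarrow>
        (\<forall>t. (\<lambda>x. shear_flow u1 u3 x t) \<in> componentwise (C0_holder \<Omega> (\<alpha>\<^sup>2)))) \<and>
     (\<exists>u1 u3 \<alpha>. fun_on \<Omega> u1 \<and> fun_on \<Omega> u3 \<and>
        weak_solution \<Omega> (shear_flow u1 u3) (\<lambda>x. shear_flow u1 u3 x 0) \<and>
        0 < \<alpha> \<and> \<alpha> < 1 \<and>
        (\<lambda>x. shear_flow u1 u3 x 0) \<in> componentwise (C0_holder \<Omega> \<alpha>) \<and>
        (\<forall>t. t \<noteq> 0 \<longrightarrow> (\<forall>\<beta>. \<beta> > \<alpha>\<^sup>2 \<longrightarrow>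
           (\<lambda>x. shear_flow u1 u3 x t) \<notin> componentwise (C0_holder \<Omega> \<beta>))))"
proof (intro conjI allI impI)
  fix \<alpha> t and u1 u3 :: "real \<Rightarrow> real"
  show "(\<lambda>x. shear_flow u1 u3 x t) \<in> componentwise (C1_holder \<Omega> \<alpha>)"
    if "0 < \<alpha> \<and> \<alpha> \<le> 1 \<and> u1 \<in> C1_holder \<Omega> \<alpha> \<and> u3 \<in> C1_holder \<Omega> \<alpha>"
    using that by (intro C1_holder_shear_flow) auto
  show "(\<lambda>x. shear_flow u1 u3 x t) \<in> componentwise (C0_holder \<Omega> (\<alpha>\<^sup>2))"
    if "0 < \<alpha> \<and> \<alpha> < 1 \<and> u1 \<in> C0_holder \<Omega> \<alpha> \<and> u3 \<in> C0_holder \<Omega> \<alpha>"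
    using that by (intro C0_holder_shear_flow) auto
next
  have "weak_solution \<Omega> (shear_flow cusp cusp) (\<lambda>x. shear_flow cusp cusp x 0)"
    by (intro weak_solution_shear_flow[where B = 1] cusp_fun_on cusp_bounded
      C0_holder_continuous[OF cusp_in_C0_holder]) simp_all
  \<comment> \<open>At time 0 no composition takes place: the third component is
    \<open>cusp (x $ 1)\<close> and has the full exponent 1/2, whose square is the threshold
    1/4.\<close>
  moreover have "(\<lambda>x. shear_flow cusp cusp x 0) \<in> componentwise (C0_holder \<Omega> (1 / 2))"
    using C0_holder_component[OF cusp_in_C0_holder] C0_holder_const[of "1 / 2" 0]
    by (simp add: componentwise_def forall_3)
  ultimately show "\<exists>u1 u3 \<alpha>. fun_on \<Omega> u1 \<and> fun_on \<Omega> u3 \<and>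
      weak_solution \<Omega> (shear_flow u1 u3) (\<lambda>x. shear_flow u1 u3 x 0) \<and>
      0 < \<alpha> \<and> \<alpha> < 1 \<and>
      (\<lambda>x. shear_flow u1 u3 x 0) \<in> componentwise (C0_holder \<Omega> \<alpha>) \<and>
      (\<forall>t. t \<noteq> 0 \<longrightarrow> (\<forall>\<beta>. \<beta> > \<alpha>\<^sup>2 \<longrightarrow>
         (\<lambda>x. shear_flow u1 u3 x t) \<notin> componentwise (C0_holder \<Omega> \<beta>)))"
    using shear_flow_cusp_not_holder cusp_fun_on
    by (intro exI[of _ cusp] exI[of _ "1 / 2"]) (auto simp: power_divide)
qed

end
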